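(* Let $p$ be an odd prime, let $m\ge 5$ be an odd integer, and let $k$ be a positive integer with $\gcd(m,k)=1$. For $\alpha,\beta,\gamma\in\mathbb{F}_{p^m}$ let $$T(\alpha,\beta,\gamma)=\sum_{x\in\mathbb{F}_{p^m}}\zeta_p^{\mathrm{Tr}(\alpha x^{p^{2k}+1}+\beta x^{p^k+1}+\gamma x^2)}.$$ Then, as $(\alpha,\beta,\gamma)$ runs through $\mathbb{F}_{p^m}^3$, the sum $T(\alpha,\beta,\gamma)$ takes exactly the following values with the following frequencies (number of triples $(\alpha,\beta,\gamma)$): - each of $\sqrt{p^*}\,p^{\frac{m-1}{2}}$ and $-\sqrt{p^*}\,p^{\frac{m-1}{2}}$ occurs $n_{1,0}=n_{-1,0}$ times; - $p^{\frac{m+1}{2}}$ occurs $n_{1,1}$ times, and $-p^{\frac{m+1}{2}}$ occurs $n_{-1,1}$ times; - each of $\sqrt{p^*}\,p^{\frac{m+1}{2}}$ and $-\sqrt{p^*}\,p^{\frac{m+1}{2}}$ occurs $n_{1,2}=n_{-1,2}$ times; - $p^{\frac{m+3}{2}}$ occurs $n_{1,3}$ times, and $-p^{\frac{m+3}{2}}$ occurs $n_{-1,3}$ times; - each of $\sqrt{p^*}\,p^{\frac{m+3}{2}}$ and $-\sqrt{p^*}\,p^{\frac{m+3}{2}}$ occurs $n_{1,4}=n_{-1,4}$ times; - $p^m$ occurs once; where, for $\varepsilon\in\{1,-1\}$, $$n_{\varepsilon,1}=\frac{(p^{m+1}+\varepsilon p^{(m+3)/2})(p^{2m}-p^{2m-2}-p^{2m-3}+p^{m-2}+p^{m-3}-1)}{2(p^2-1)},$$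 $$n_{\varepsilon,3}=\frac{(p^{m-3}+\varepsilon p^{(m-3)/2})(p^{m-1}-1)(p^m-1)}{2(p^2-1)},$$ $$n_{1,2}=n_{-1,2}=\frac{p^2(p^{m-1}-1)(p^{2m}-p^{2m-2}-p^{2m-3}+p^{m-2}+p^{m-3}-1)}{2(p^2-1)^2},$$ $$n_{1,4}=n_{-1,4}=\frac{(p^m-1)(p^{m-1}-1)(p^{m-3}-1)}{2(p^2-1)(p^4-1)},$$ $$n_{1,0}=n_{-1,0}=\tfrac12(p^m-1)(p^{2m}-p^{2m-1}+p^{2m-4}+p^m-p^{m-1}-p^{m-3}+1)-n_{1,2}-n_{1,4}.$$
   Context: $\mathrm{Tr}$ denotes the trace map from $\mathbb{F}_{p^m}$ to $\mathbb{F}_p$, and $\zeta_p=e^{2\pi i/p}$. Put $p^*=(-1)^{\frac{p-1}{2}}p$, with $\sqrt{p^*}=\sqrt p$ if $p\equiv 1\pmod 4$ and $\sqrt{p^*}=i\sqrt p$ if $p\equiv 3\pmod 4$. *)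

theory Defs
  imports Complex_Main "HOL-Library.Cardinality" "HOL-Computational_Algebra.Computational_Algebra"
    "HOL-Number_Theory.Cong"
begin

definition field_trace :: "nat \<Rightarrow> nat \<Rightarrow> 'a::finite_field \<Rightarrow> 'a" where
  "field_trace p m x = (\<Sum>i<m. x ^ (p ^ i))"

text \<open>
  The prime field of \<open>'a\<close> is the image of \<^const>\<open>of_nat\<close>. The following function inverts this
  identification of the prime field with the residues \<open>0, \<dots>, CHAR('a) - 1\<close>; it is only used for
  elements of the prime field.
\<close>
definition prime_field_residue :: "'a::finite_field \<Rightarrow> nat" where
  "prime_field_residue a = (THE n. n < CHAR('a) \<and> of_nat n = a)"

definition zeta :: "nat \<Rightarrow> complex" where
  "zeta p = exp (2 * of_real pi * \<i> / of_nat p)"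

definition exp_sum_T :: "nat \<Rightarrow> nat \<Rightarrow> nat \<Rightarrow> 'a::finite_field \<Rightarrow> 'a \<Rightarrow> 'a \<Rightarrow> complex" where
  "exp_sum_T p m k \<alpha> \<beta> \<gamma> =
     (\<Sum>x\<in>UNIV. zeta p ^ prime_field_residue (field_trace p m
        (\<alpha> * x ^ (p ^ (2 * k) + 1) + \<beta> * x ^ (p ^ k + 1) + \<gamma> * x ^ 2)))"

definition pstar :: "nat \<Rightarrow> int" where
  "pstar p = (- 1) ^ ((p - 1) div 2) * int p"

definition sqrt_pstar :: "nat \<Rightarrow> complex" where
  "sqrt_pstar p = (if p mod 4 = 1 then of_real (sqrt (real p)) else \<i> * of_real (sqrt (real p)))"

text \<open>
  Below, \<open>m\<close> is odd and at least \<open>5\<close>, so that the truncated subtractions and the divisions by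
  \<open>2\<close> in the exponents are exact. The argument \<open>\<epsilon>\<close> stands for a sign. The frequencies
  \<open>n\<^bsub>\<epsilon>,0\<^esub>\<close>, \<open>n\<^bsub>\<epsilon>,2\<^esub>\<close>, \<open>n\<^bsub>\<epsilon>,4\<^esub>\<close> do not depend on it.
\<close>

definition freq1 :: "int \<Rightarrow> nat \<Rightarrow> nat \<Rightarrow> real" where
  "freq1 \<epsilon> p m =
     (real p ^ (m + 1) + of_int \<epsilon> * real p ^ ((m + 3) div 2)) *
     (real p ^ (2 * m) - real p ^ (2 * m - 2) - real p ^ (2 * m - 3)
        + real p ^ (m - 2) + real p ^ (m - 3) - 1)
     / (2 * (real p ^ 2 - 1))"

definition freq3 :: "int \<Rightarrow> nat \<Rightarrow> nat \<Rightarrow> real" where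
  "freq3 \<epsilon> p m =
     (real p ^ (m - 3) + of_int \<epsilon> * real p ^ ((m - 3) div 2)) *
     (real p ^ (m - 1) - 1) * (real p ^ m - 1)
     / (2 * (real p ^ 2 - 1))"

definition freq2 :: "nat \<Rightarrow> nat \<Rightarrow> real" where
  "freq2 p m =
     real p ^ 2 * (real p ^ (m - 1) - 1) *
     (real p ^ (2 * m) - real p ^ (2 * m - 2) - real p ^ (2 * m - 3)
        + real p ^ (m - 2) + real p ^ (m - 3) - 1)
     / (2 * (real p ^ 2 - 1) ^ 2)"

definition freq4 :: "nat \<Rightarrow> nat \<Rightarrow> real" where
  "freq4 p m =
     (real p ^ m - 1) * (real p ^ (m - 1) - 1) * (real p ^ (m - 3) - 1)
     / (2 * (real p ^ 2 - 1) * (real p ^ 4 - 1))"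

definition freq0 :: "nat \<Rightarrow> nat \<Rightarrow> real" where
  "freq0 p m =
     1 / 2 * (real p ^ m - 1) *
     (real p ^ (2 * m) - real p ^ (2 * m - 1) + real p ^ (2 * m - 4)
        + real p ^ m - real p ^ (m - 1) - real p ^ (m - 3) + 1)
     - freq2 p m - freq4 p m"

text \<open>The definitions above are consistent with their intended meaning.\<close>

lemma sqrt_pstar_squared:
  assumes "odd p"
  shows "sqrt_pstar p ^ 2 = of_int (pstar p)"
proof -
  obtain r where r: "p = 2 * r + 1" using assms by (elim oddE)
  have s: "complex_of_real (sqrt (real p)) ^ 2 = of_nat p"
    by (simp flip: of_real_power)
  have e: "p mod 4 = 1 \<longleftrightarrow> even r" unfolding r by presburger
  show ?thesis
    unfolding sqrt_pstar_def pstar_def e using s by (auto simp: r power_mult_distrib)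
qed

lemma CHAR_eq_of_card:
  assumes "prime p" "CARD('a::finite_field) = p ^ m"
  shows "CHAR('a) = p"
proof -
  have pr: "prime CHAR('a)" by simp
  have "(\<Sum>x\<in>(UNIV :: 'a set). x) = (\<Sum>x\<in>(UNIV :: 'a set). x + 1)"
    by (rule sum.reindex_bij_witness[of _ "\<lambda>x. x + 1" "\<lambda>x. x - 1"]) auto
  hence "of_nat CARD('a) = (0 :: 'a)" by (simp add: sum.distrib)
  hence "CHAR('a) dvd p ^ m"
    unfolding of_nat_eq_0_iff_char_dvd assms(2) .
  hence "CHAR('a) dvd p" using pr prime_dvd_power by blast
  thus ?thesis using pr assms(1) primes_dvd_imp_eq by blast
qed

lemma of_nat_inj_below_CHAR:
  assumes "a < CHAR('a::finite_field)" "b < CHAR('a)" "(of_nat a :: 'a) = of_nat b"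
  shows "a = b"
  using assms cong_less_modulus_unique_nat unfolding of_nat_eq_iff_cong_CHAR by blast

lemma prime_field_iff:
  fixes x :: "'a::finite_field"
  shows "x ^ CHAR('a) = x \<longleftrightarrow> (\<exists>n<CHAR('a). x = of_nat n)"
proof -
  let ?c = "CHAR('a)"
  define q :: "'a poly" where "q = monom 1 ?c - monom 1 1"
  have c: "?c > 1" using CHAR_prime[where 'a='a] prime_gt_1_nat by blast
  have "coeff q ?c = 1" using c by (simp add: q_def)
  hence q: "q \<noteq> 0" by auto
  have deg: "degree q \<le> ?c"
    unfolding q_def using c by (intro degree_diff_le order.trans[OF degree_monom_le]) auto
  have roots: "{x. poly q x = 0} = {x. x ^ ?c = x}"
    by (auto simp: q_def poly_monom)
  have fin: "finite {x :: 'a. x ^ ?c = x}" by simp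
  have "card {x :: 'a. x ^ ?c = x} \<le> ?c"
    using card_poly_roots_bound[OF q] deg unfolding roots by linarith
  moreover have "card ((of_nat :: nat \<Rightarrow> 'a) ` {..<?c}) = ?c"
    by (subst card_image) (auto simp: inj_on_def intro: of_nat_inj_below_CHAR)
  moreover have "(of_nat :: nat \<Rightarrow> 'a) ` {..<?c} \<subseteq> {x. x ^ ?c = x}"
  proof -
    have "(of_nat n :: 'a) ^ ?c = of_nat n" for n
    proof (induction n)
      case 0
      show ?case using c by simp
    next
      case (Suc n)
      thus ?case using freshmans_dream[of ?c "1 :: 'a" "of_nat n"] by simp
    qed
    thus ?thesis by auto
  qed
  ultimately have "(of_nat :: nat \<Rightarrow> 'a) ` {..<?c} = {x. x ^ ?c = x}"
    using fin by (intro card_seteq) auto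
  thus ?thesis by (auto simp: set_eq_iff image_iff)
qed

lemma of_nat_residue_trace:
  fixes x :: "'a::finite_field"
  assumes "prime p" "CARD('a) = p ^ m"
  shows "prime_field_residue (field_trace p m x) < p"
    and "of_nat (prime_field_residue (field_trace p m x)) = field_trace p m x"
proof -
  have c: "CHAR('a) = p" by (rule CHAR_eq_of_card[OF assms])
  have *: "(x ^ (p ^ i)) ^ p = x ^ (p ^ Suc i)" for i
    by (simp only: power_Suc2 power_mult)
  have "field_trace p m x ^ p = (\<Sum>i<m. (x ^ (p ^ i)) ^ p)"
    unfolding field_trace_def by (rule freshmans_dream_sum) (simp_all only: c assms(1))
  also have "\<dots> = (\<Sum>i<m. x ^ (p ^ Suc i))"
    by (simp only: *)
  also have "\<dots> = (\<Sum>i<Suc m. x ^ (p ^ i)) - x"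
    by (subst sum.lessThan_Suc_shift) simp
  also have "\<dots> = field_trace p m x + x ^ (p ^ m) - x"
    by (simp only: sum.lessThan_Suc field_trace_def)
  also have "x ^ (p ^ m) = x"
    using finite_field_power_card_eq_same[of x] unfolding assms(2) .
  also have "field_trace p m x + x - x = field_trace p m x" by simp
  finally have "\<exists>n<CHAR('a). field_trace p m x = of_nat n"
    using prime_field_iff[of "field_trace p m x"] unfolding c by (metis (no_types))
  then obtain n where "n < CHAR('a)" "of_nat n = field_trace p m x" by metis
  then have "\<exists>!n. n < CHAR('a) \<and> of_nat n = field_trace p m x"
    by (intro ex1I[of _ n]) (auto intro: of_nat_inj_below_CHAR)
  from theI'[OF this]
  show "prime_field_residue (field_trace p m x) < p"
    and "of_nat (prime_field_residue (field_trace p m x)) = field_trace p m x"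
    unfolding prime_field_residue_def c by blast+
qed

end

theory Submission
  imports Defs
begin

text \<open>
  For \<open>Q = (\<alpha>, \<beta>, \<gamma>)\<close> the sum \<open>T Q\<close> is the exponential sum of a quadratic form over the prime
  field, so diagonalising the form and evaluating quadratic Gauss sums expresses it through the rank
  of the form up to sign. The radical is the kernel of a nonzero \<open>\<sigma>\<close>-polynomial of degree at most
  \<open>4\<close>, where \<open>\<sigma>\<close> is the \<open>k\<close>-th power of the Frobenius map. As \<open>\<sigma>\<close> fixes only the prime field,
  the rank of a nonzero form is at least \<open>m - 4\<close>.

  The frequencies follow from moments. Let \<open>l\<close> be a nonsquare of the prime field; replacing \<open>Q\<close> by
  \<open>l Q\<close> multiplies \<open>T\<close> by \<open>(- 1) ^ rank\<close>. This gives the symmetry between the two signs in odd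
  rank. Moreover, the sums over all \<open>Q\<close> of \<open>T Q * T (- Q)\<close>, \<open>T Q * T (- l Q)\<close> and of their products
  with \<open>T Q * T (- Q)\<close> separate the even from the odd ranks. Together with the sums of \<open>1\<close>, \<open>T Q\<close> and
  \<open>T Q ^ 2 * T (- Q)\<close> these determine all frequencies. Each moment counts the solutions of three
  homogeneous equations; after scaling, the first two of them factor so as to force the coordinates
  into the prime field.
\<close>

text \<open>Call \<open>i = m - rank\<close> the corank. Ten frequencies are unknown, two for each
  corank \<open>i \<le> 4\<close>. The symmetry in odd rank removes three of them, and seven moments
  have to supply the rest. \<open>T (- Q)\<close> is the complex conjugate of \<open>T Q\<close>, so
  \<open>T Q * T (- Q)\<close> equals \<open>p ^ (m + i)\<close> and is blind to the sign of
  \<open>T Q\<close>. The absolute moments of order 0, 2 and 4 thus give only three equations for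
  the five numbers of triples of given corank, and the absolute moment of order 6 would lead to
  systems in six variables. The nonsquare twist yields the two missing equations with at most four
  variables: it replaces a hyperbolic plane by an anisotropic one, whose zeros are just as easy to
  count. For this a nonsquare of the prime field must remain a nonsquare in the whole field, which
  is a consequence of \<open>m\<close> being odd. The differences between the two signs in even rank
  then follow from the moments of order 1 and 3.\<close>

lemma sum_UNIV_prod:
  fixes f :: "'b::finite \<times> 'c::finite \<Rightarrow> 'd::comm_monoid_add"
  shows "sum f UNIV = (\<Sum>a\<in>UNIV. \<Sum>b\<in>UNIV. f (a, b))"
  by (simp add: sum.cartesian_product case_prod_unfold)

lemma card_fibres:
  fixes M :: "('b::finite \<times> 'c::finite) set"
  shows "card M = (\<Sum>x\<in>UNIV. card {t. (x, t) \<in> M})"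
proof -
  have "M = (SIGMA x:UNIV. {t. (x, t) \<in> M})" by auto
  thus ?thesis by (metis card_SigmaI finite)
qed

lemma sum_atMost_4: "(\<Sum>i\<le>(4::nat). f i) = f 0 + f 1 + f 2 + f 3 + (f 4 :: 'b::comm_monoid_add)"
  by (simp add: numeral_eq_Suc)

text \<open>
  In the next lemma \<open>P = p\<close>, \<open>y = p ^ ((m - 5) div 2)\<close> and \<open>Q = p ^ m\<close>. The even and the odd
  ranks separate, because they enter the equations \<open>e2'\<close> and \<open>e4'\<close> with opposite signs.
\<close>
lemma solve_moment_equations:
  fixes P y Q A :: real and a b :: "nat \<Rightarrow> real"
  assumes P: "P > 1" and y: "y > 0" and Q: "Q = P ^ 5 * y ^ 2"
    and A: "A = P ^ 10 * y ^ 4 - P ^ 8 * y ^ 4 - P ^ 7 * y ^ 4 + P ^ 3 * y ^ 2 + P ^ 2 * y ^ 2 - 1"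
    and ab: "b 0 = a 0" "b 2 = a 2" "b 4 = a 4"
    and e0: "Q ^ 3 = 1 + (\<Sum>i\<le>4. a i + b i)"
    and e2: "Q ^ 3 * (2 * Q - 1) = Q ^ 2 + (\<Sum>i\<le>4. (a i + b i) * (Q * P ^ i))"
    and e2': "Q ^ 3 = Q ^ 2 + (\<Sum>i\<le>4. (a i + b i) * ((- 1) ^ Suc i * (Q * P ^ i)))"
    and e4: "Q ^ 3 * (Q * (2 * Q - 1) + (Q - 1) * (Q ^ 2 - (Q - P) ^ 2)) =
      Q ^ 4 + (\<Sum>i\<le>4. (a i + b i) * (Q * P ^ i) ^ 2)"
    and e4': "Q ^ 3 * (Q + (Q - 1) * P ^ 2) =
      Q ^ 4 + (\<Sum>i\<le>4. (a i + b i) * ((- 1) ^ Suc i * (Q * P ^ i) ^ 2))"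
    and e1: "Q ^ 3 = Q + (a 1 - b 1) * (P ^ 3 * y) + (a 3 - b 3) * (P ^ 4 * y)"
    and e3: "Q ^ 3 * (Q + (Q - 1) * P) = Q ^ 3 + (a 1 - b 1) * (P ^ 3 * y * (Q * P))
      + (a 3 - b 3) * (P ^ 4 * y * (Q * P ^ 3))"
  shows "a 1 = (P ^ 6 * y ^ 2 + P ^ 4 * y) * A / (2 * (P ^ 2 - 1))"
    "b 1 = (P ^ 6 * y ^ 2 - P ^ 4 * y) * A / (2 * (P ^ 2 - 1))"
    "a 3 = (P ^ 2 * y ^ 2 + P * y) * (P ^ 4 * y ^ 2 - 1) * (Q - 1) / (2 * (P ^ 2 - 1))"
    "b 3 = (P ^ 2 * y ^ 2 - P * y) * (P ^ 4 * y ^ 2 - 1) * (Q - 1) / (2 * (P ^ 2 - 1))"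
    "a 2 = P ^ 2 * (P ^ 4 * y ^ 2 - 1) * A / (2 * (P ^ 2 - 1) ^ 2)"
    "a 4 = (Q - 1) * (P ^ 4 * y ^ 2 - 1) * (P ^ 2 * y ^ 2 - 1) / (2 * (P ^ 2 - 1) * (P ^ 4 - 1))"
    "a 0 = 1 / 2 * (Q - 1) * (P ^ 10 * y ^ 4 - P ^ 9 * y ^ 4 + P ^ 6 * y ^ 4 + Q
        - P ^ 4 * y ^ 2 - P ^ 2 * y ^ 2 + 1) - a 2 - a 4"
proof -
  have nz: "P \<noteq> 0" "y \<noteq> 0" "Q \<noteq> 0" using P y Q by auto
  have "P ^ 2 > 1" "P ^ 4 > 1" by (rule one_less_power[OF P], simp)+
  hence nz2: "P ^ 2 - 1 \<noteq> 0" "P ^ 4 - 1 \<noteq> 0" by linarith+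
  define u where "u i = a i + b i" for i
  define d1 d3 where "d1 = a 1 - b 1" and "d3 = a 3 - b 3"
  note E = e0[folded u_def, unfolded sum_atMost_4] e2[folded u_def, unfolded sum_atMost_4]
    e2'[folded u_def, unfolded sum_atMost_4] e4[folded u_def, unfolded sum_atMost_4]
    e4'[folded u_def, unfolded sum_atMost_4]
  have odd2: "u 1 * P + u 3 * P ^ 3 = Q ^ 3 - Q"
  proof -
    have "(2 * Q) * (u 1 * P + u 3 * P ^ 3) = (2 * Q) * (Q ^ 3 - Q)"
      using E(2,3) by (simp add: algebra_simps power_numeral_reduce)
    thus ?thesis using nz by simp
  qed
  have even2: "u 0 + u 2 * P ^ 2 + u 4 * P ^ 4 = Q ^ 2 * (Q - 1)"
  proof -
    have "(2 * Q) * (u 0 + u 2 * P ^ 2 + u 4 * P ^ 4) = (2 * Q) * (Q ^ 2 * (Q - 1))"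
      using E(2,3) by (simp add: algebra_simps power_numeral_reduce)
    thus ?thesis using nz by simp
  qed
  have odd4: "u 1 * P ^ 2 + u 3 * P ^ 6 = Q ^ 2 * (Q - 1) * (1 + P)"
  proof -
    have "(2 * Q ^ 2) * (u 1 * P ^ 2 + u 3 * P ^ 6) = (2 * Q ^ 2) * (Q ^ 2 * (Q - 1) * (1 + P))"
      using E(4,5) by (simp add: algebra_simps power_numeral_reduce)
    thus ?thesis using nz by simp
  qed
  have even4: "u 0 + u 2 * P ^ 4 + u 4 * P ^ 8 = Q * (Q - 1) * (Q + P * Q - P ^ 2)"
  proof -
    have "(2 * Q ^ 2) * (u 0 + u 2 * P ^ 4 + u 4 * P ^ 8) =
        (2 * Q ^ 2) * (Q * (Q - 1) * (Q + P * Q - P ^ 2))"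
      using E(4,5) by (simp add: algebra_simps power_numeral_reduce)
    thus ?thesis using nz by simp
  qed
  have u3: "u 3 * (P ^ 2 - 1) = P ^ 2 * y ^ 2 * (Q - 1) * (P ^ 4 * y ^ 2 - 1)"
  proof -
    have "P ^ 4 * (u 3 * (P ^ 2 - 1)) = (u 1 * P ^ 2 + u 3 * P ^ 6) - P * (u 1 * P + u 3 * P ^ 3)"
      by (simp add: algebra_simps power_numeral_reduce)
    also have "\<dots> = P ^ 4 * (P ^ 2 * y ^ 2 * (Q - 1) * (P ^ 4 * y ^ 2 - 1))"
      unfolding odd2 odd4 Q by (simp add: algebra_simps power_numeral_reduce)
    finally show ?thesis using nz by simp
  qed
  have u1: "u 1 * (P ^ 2 - 1) = P ^ 6 * y ^ 2 * A"
  proof -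
    have "P * (u 1 * (P ^ 2 - 1)) =
        (P ^ 2 - 1) * (u 1 * P + u 3 * P ^ 3) - P ^ 3 * (u 3 * (P ^ 2 - 1))"
      by (simp add: algebra_simps power_numeral_reduce)
    also have "\<dots> = P * (P ^ 6 * y ^ 2 * A)"
      unfolding odd2 u3 Q A by (simp add: algebra_simps power_numeral_reduce)
    finally show ?thesis using nz by simp
  qed
  let ?R = "P ^ 10 * y ^ 4 - P ^ 9 * y ^ 4 + P ^ 6 * y ^ 4 + Q - P ^ 4 * y ^ 2 - P ^ 2 * y ^ 2 + 1"
  \<comment> \<open>The number of all triples does not separate the parities; the odd coranks,
    already known, are subtracted from it.\<close>
  have even0: "u 0 + u 2 + u 4 = (Q - 1) * ?R"
  proof -
    have "(P ^ 2 - 1) * (u 0 + u 2 + u 4) =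
        (P ^ 2 - 1) * (Q ^ 3 - 1) - u 1 * (P ^ 2 - 1) - u 3 * (P ^ 2 - 1)"
      unfolding E(1) by (simp add: algebra_simps)
    also have "\<dots> = (P ^ 2 - 1) * ((Q - 1) * ?R)"
      unfolding u1 u3 Q A by (simp add: algebra_simps power_numeral_reduce)
    finally show ?thesis using nz2(1) mult_left_cancel by blast
  qed
  have u4: "u 4 * (P ^ 2 - 1) * (P ^ 4 - 1) = (Q - 1) * (P ^ 4 * y ^ 2 - 1) * (P ^ 2 * y ^ 2 - 1)"
  proof -
    \<comment> \<open>The coefficients are those of \<open>(X - 1) * (X - P ^ 2)\<close>, which at
      \<open>X = P ^ i\<close> vanishes for \<open>i = 0\<close> and \<open>i = 2\<close> and so
      isolates \<open>u 4\<close>.\<close>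
    have "P ^ 2 * (u 4 * (P ^ 2 - 1) * (P ^ 4 - 1)) =
        (u 0 + u 2 * P ^ 4 + u 4 * P ^ 8) - (1 + P ^ 2) * (u 0 + u 2 * P ^ 2 + u 4 * P ^ 4)
          + P ^ 2 * (u 0 + u 2 + u 4)"
      by (simp add: algebra_simps power_numeral_reduce)
    also have "\<dots> = P ^ 2 * ((Q - 1) * (P ^ 4 * y ^ 2 - 1) * (P ^ 2 * y ^ 2 - 1))"
      unfolding even0 even2 even4 Q by (simp add: algebra_simps power_numeral_reduce)
    finally show ?thesis using nz by simp
  qed
  have u2: "u 2 * (P ^ 2 - 1) ^ 2 = P ^ 2 * (P ^ 4 * y ^ 2 - 1) * A"
  proof -
    have "u 2 * (P ^ 2 - 1) ^ 2 = (P ^ 2 - 1) * ((u 0 + u 2 * P ^ 2 + u 4 * P ^ 4) - (u 0 + u 2 + u 4))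
        - u 4 * (P ^ 2 - 1) * (P ^ 4 - 1)"
      by (simp add: algebra_simps power_numeral_reduce)
    also have "\<dots> = P ^ 2 * (P ^ 4 * y ^ 2 - 1) * A"
      unfolding even0 even2 u4 Q A by (simp add: algebra_simps power_numeral_reduce)
    finally show ?thesis .
  qed
  have f1: "d1 + d3 * P = P ^ 2 * y * (Q ^ 2 - 1)"
  proof -
    have "(P ^ 3 * y) * (d1 + d3 * P) = Q ^ 3 - Q"
      using e1 by (simp add: d1_def d3_def algebra_simps power_numeral_reduce)
    also have "\<dots> = (P ^ 3 * y) * (P ^ 2 * y * (Q ^ 2 - 1))"
      unfolding Q by (simp add: algebra_simps power_numeral_reduce)
    finally show ?thesis using nz by simp
  qed
  have f3: "d1 + d3 * P ^ 3 = P ^ 6 * y ^ 3 * (Q - 1) * (1 + P)"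
  proof -
    have "(P ^ 4 * y * Q) * (d1 + d3 * P ^ 3) = Q ^ 3 * (Q + (Q - 1) * P) - Q ^ 3"
      using e3 by (simp add: d1_def d3_def algebra_simps power_numeral_reduce)
    also have "\<dots> = (P ^ 4 * y * Q) * (P ^ 6 * y ^ 3 * (Q - 1) * (1 + P))"
      unfolding Q by (simp add: algebra_simps power_numeral_reduce)
    finally show ?thesis using nz by simp
  qed
  have d3: "d3 * (P ^ 2 - 1) = P * y * (P ^ 4 * y ^ 2 - 1) * (Q - 1)"
  proof -
    have "P * (d3 * (P ^ 2 - 1)) = (d1 + d3 * P ^ 3) - (d1 + d3 * P)"
      by (simp add: algebra_simps power_numeral_reduce)
    also have "\<dots> = P * (P * y * (P ^ 4 * y ^ 2 - 1) * (Q - 1))"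
      unfolding f1 f3 Q by (simp add: algebra_simps power_numeral_reduce)
    finally show ?thesis using nz by simp
  qed
  have d1: "d1 * (P ^ 2 - 1) = P ^ 4 * y * A"
  proof -
    have "d1 * (P ^ 2 - 1) = (P ^ 2 - 1) * (d1 + d3 * P) - P * (d3 * (P ^ 2 - 1))"
      by (simp add: algebra_simps)
    also have "\<dots> = P ^ 4 * y * A"
      unfolding f1 d3 Q A by (simp add: algebra_simps power_numeral_reduce)
    finally show ?thesis .
  qed
  have half: "x = c / (2 * e)" if "2 * x * e = c" "e \<noteq> 0" for x c e :: real
    using that by (simp add: field_simps)
  show "a 1 = (P ^ 6 * y ^ 2 + P ^ 4 * y) * A / (2 * (P ^ 2 - 1))"
    using u1 d1 by (intro half nz2) (simp add: u_def d1_def algebra_simps)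
  show "b 1 = (P ^ 6 * y ^ 2 - P ^ 4 * y) * A / (2 * (P ^ 2 - 1))"
    using u1 d1 by (intro half nz2) (simp add: u_def d1_def algebra_simps)
  show "a 3 = (P ^ 2 * y ^ 2 + P * y) * (P ^ 4 * y ^ 2 - 1) * (Q - 1) / (2 * (P ^ 2 - 1))"
    using u3 d3 by (intro half nz2) (simp add: u_def d3_def algebra_simps)
  show "b 3 = (P ^ 2 * y ^ 2 - P * y) * (P ^ 4 * y ^ 2 - 1) * (Q - 1) / (2 * (P ^ 2 - 1))"
    using u3 d3 by (intro half nz2) (simp add: u_def d3_def algebra_simps)
  show "a 2 = P ^ 2 * (P ^ 4 * y ^ 2 - 1) * A / (2 * (P ^ 2 - 1) ^ 2)"
    using u2 nz2 by (intro half) (simp_all add: u_def ab)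
  have "a 4 = (Q - 1) * (P ^ 4 * y ^ 2 - 1) * (P ^ 2 * y ^ 2 - 1) / (2 * ((P ^ 2 - 1) * (P ^ 4 - 1)))"
    using u4 nz2 by (intro half) (simp_all add: u_def ab mult.assoc)
  thus "a 4 = (Q - 1) * (P ^ 4 * y ^ 2 - 1) * (P ^ 2 * y ^ 2 - 1) / (2 * (P ^ 2 - 1) * (P ^ 4 - 1))"
    by (simp only: mult.assoc)
  show "a 0 = 1 / 2 * (Q - 1) * ?R - a 2 - a 4"
    using even0 by (simp add: u_def ab)
qed

section \<open>Characters and quadratic forms over the prime field\<close>

text \<open>The numbers \<open>p\<close> and \<open>m\<close> do not mention the field, so
  \<open>ty\<close> is what ties the locale to the type \<open>'a\<close>.\<close>

locale odd_char_field =
  fixes p m :: nat and ty :: "'a::finite_field itself"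
  assumes prime_p: "prime p" and odd_p: "odd p"
    and card_field: "CARD('a) = p ^ m"
begin

lemma CHAR_eq: "CHAR('a) = p"
  by (rule CHAR_eq_of_card[OF prime_p card_field])

lemma p_gt_2: "p > 2"
  using prime_p odd_p by (metis even_numeral le_neq_implies_less prime_ge_2_nat)

lemma two_neq_0: "(2 :: 'a) \<noteq> 0"
proof
  assume "(2 :: 'a) = 0"
  hence "of_nat 2 = (0 :: 'a)" by simp
  hence "p dvd 2" unfolding of_nat_eq_0_iff_char_dvd CHAR_eq .
  thus False using p_gt_2 by (auto dest: dvd_imp_le)
qed

lemma neg_eq_self_iff: "- x = x \<longleftrightarrow> x = (0 :: 'a)"
proof -
  have "- x = x \<longleftrightarrow> 2 * x = 0"
    by (metis add.right_inverse mult_2 neg_eq_iff_add_eq_0)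
  thus ?thesis using two_neq_0 by simp
qed

section \<open>Frobenius powers and the prime field\<close>

lemma frob_add: "(x + y :: 'a) ^ (p ^ j) = x ^ (p ^ j) + y ^ (p ^ j)"
  by (rule freshmans_dream') (simp_all add: CHAR_eq prime_p)

lemma frob_minus: "(- x :: 'a) ^ (p ^ j) = - (x ^ (p ^ j))"
  using odd_p by simp

lemma frob_diff: "(x - y :: 'a) ^ (p ^ j) = x ^ (p ^ j) - y ^ (p ^ j)"
  using frob_add[of x "- y" j] by (simp only: frob_minus diff_conv_add_uminus)

lemma frob_sum: "(\<Sum>i\<in>A. f i :: 'a) ^ (p ^ j) = (\<Sum>i\<in>A. f i ^ (p ^ j))"
  by (rule freshmans_dream_sum') (simp_all add: CHAR_eq prime_p)

lemma frob_comp: "((x :: 'a) ^ (p ^ i)) ^ (p ^ j) = x ^ (p ^ (i + j))"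
  by (simp only: power_mult[symmetric] power_add)

lemma frob_eq_0: "(x :: 'a) ^ (p ^ j) = 0 \<longleftrightarrow> x = 0"
  using prime_p prime_gt_0_nat by auto

lemma frob_m: "(x :: 'a) ^ (p ^ m) = x"
  using finite_field_power_card_eq_same[of x] unfolding card_field .

lemma frob_inj: "(x :: 'a) ^ (p ^ j) = y ^ (p ^ j) \<longleftrightarrow> x = y"
  using frob_eq_0[of "x - y" j] by (auto simp: frob_diff)

lemma frob_bij: "bij (\<lambda>x :: 'a. x ^ (p ^ j))"
  by (simp add: finite_UNIV_inj_surj bij_def inj_def frob_inj)

text \<open>Taken as the fixed points of Frobenius, so that closure under the field operations comes
  from the Frobenius laws; \<open>Fp_eq\<close> recovers the residues below
  \<open>p\<close>.\<close>

definition Fp :: "'a set" where "Fp = {x. x ^ p = x}"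

lemma Fp_eq: "Fp = of_nat ` {..<p}"
  unfolding Fp_def using prime_field_iff[where 'a='a] unfolding CHAR_eq by auto

lemma of_nat_inj_p: "a < p \<Longrightarrow> b < p \<Longrightarrow> (of_nat a :: 'a) = of_nat b \<Longrightarrow> a = b"
  using of_nat_inj_below_CHAR[where 'a='a] unfolding CHAR_eq by blast

lemma inj_of_nat_Fp: "inj_on (of_nat :: nat \<Rightarrow> 'a) {..<p}"
  by (auto simp: inj_on_def intro: of_nat_inj_p)

lemma card_Fp: "card Fp = p"
  unfolding Fp_eq by (simp add: card_image inj_of_nat_Fp)

lemma Fp_0: "0 \<in> Fp" and Fp_1: "1 \<in> Fp"
  using p_gt_2 by (auto simp: Fp_def)

lemma Fp_add: "x \<in> Fp \<Longrightarrow> y \<in> Fp \<Longrightarrow> x + y \<in> Fp"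
  using frob_add[of x y 1] by (simp add: Fp_def)

lemma Fp_uminus: "x \<in> Fp \<Longrightarrow> - x \<in> Fp"
  using frob_minus[of x 1] by (simp add: Fp_def)

lemma Fp_diff: "x \<in> Fp \<Longrightarrow> y \<in> Fp \<Longrightarrow> x - y \<in> Fp"
  using frob_diff[of x y 1] by (simp add: Fp_def)

lemma Fp_mult: "x \<in> Fp \<Longrightarrow> y \<in> Fp \<Longrightarrow> x * y \<in> Fp"
  by (simp add: Fp_def power_mult_distrib)

lemma Fp_divide: "x \<in> Fp \<Longrightarrow> y \<in> Fp \<Longrightarrow> x / y \<in> Fp"
  by (simp add: Fp_def power_divide)

lemma Fp_power: "x \<in> Fp \<Longrightarrow> x ^ n \<in> Fp"
  by (simp add: Fp_def flip: power_mult) (metis mult.commute power_mult)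

lemma Fp_2: "2 \<in> Fp"
  using Fp_add[OF Fp_1 Fp_1] by simp

lemmas Fp_intros = Fp_0 Fp_1 Fp_2 Fp_add Fp_uminus Fp_diff Fp_mult Fp_divide Fp_power

lemma Fp_frob: "c \<in> Fp \<Longrightarrow> c ^ (p ^ j) = c"
proof (induction j)
  case (Suc j)
  have "c ^ (p ^ Suc j) = (c ^ (p ^ j)) ^ p" by (simp only: power_Suc2 power_mult)
  thus ?case using Suc by (simp add: Fp_def)
qed simp

section \<open>The additive character of the prime field\<close>

definition add_char :: "'a \<Rightarrow> complex" where
  "add_char a = zeta p ^ prime_field_residue a"

lemma zeta_pow_eq_1: "zeta p ^ n = 1 \<longleftrightarrow> p dvd n"
proof -
  have p0: "p > 0" using p_gt_2 by simp
  have "zeta p ^ n = exp (of_nat n * (2 * of_real pi * \<i> / of_nat p))"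
    unfolding zeta_def by (rule exp_of_nat_mult[symmetric])
  also have "of_nat n * (2 * of_real pi * \<i> / of_nat p) = (complex_of_real (2 * pi * n / p)) * \<i>"
    by simp
  also have "exp \<dots> = cis (2 * pi * n / p)"
    by (simp add: cis_conv_exp mult.commute)
  also have "\<dots> = 1 \<longleftrightarrow> cos (2 * pi * n / p) = 1"
    by (auto simp: complex_eq_iff cos_one_sin_zero)
  also have "\<dots> \<longleftrightarrow> (\<exists>j::int. 2 * pi * n / p = of_int j * 2 * pi)"
    by (rule cos_one_2pi_int)
  also have "\<dots> \<longleftrightarrow> (\<exists>j::int. int n = j * int p)"
  proof (rule ex_cong1)
    fix j :: int
    have "2 * pi * n / p = of_int j * 2 * pi \<longleftrightarrow> real n = of_int j * real p"
      using p0 by (simp add: field_simps)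
    also have "\<dots> \<longleftrightarrow> (of_int (int n) :: real) = of_int (j * int p)" by simp
    finally show "2 * pi * n / p = of_int j * 2 * pi \<longleftrightarrow> int n = j * int p"
      unfolding of_int_eq_iff .
  qed
  also have "\<dots> \<longleftrightarrow> int p dvd int n" by (auto simp: dvd_def mult.commute)
  finally show ?thesis by simp
qed

text \<open>\<open>zeta p\<close> has order \<open>p\<close>, so reducing an exponent modulo
  \<open>p\<close> does no harm. This makes \<open>add_char\<close> multiplicative on sums although
  the residue map itself is not additive.\<close>

lemma add_char_of_nat: "add_char (of_nat n) = zeta p ^ n"
proof -
  have p0: "p > 0" using p_gt_2 by simp
  have "(of_nat (n mod p) :: 'a) = of_nat n"
    using of_nat_eq_iff_cong_CHAR[where 'a='a, of "n mod p" n] by (simp add: CHAR_eq cong_def)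
  hence "prime_field_residue (of_nat n :: 'a) = n mod p"
    unfolding prime_field_residue_def CHAR_eq using p0
    by (intro the_equality) (auto intro: of_nat_inj_p)
  moreover have "zeta p ^ n = zeta p ^ (p * (n div p) + n mod p)" by simp
  moreover have "zeta p ^ (p * (n div p) + n mod p) = zeta p ^ (n mod p)"
    unfolding power_add using zeta_pow_eq_1[of "p * (n div p)"] by simp
  ultimately show ?thesis unfolding add_char_def by simp
qed

lemma add_char_add: "a \<in> Fp \<Longrightarrow> b \<in> Fp \<Longrightarrow> add_char (a + b) = add_char a * add_char b"
  unfolding Fp_eq by (auto simp: add_char_of_nat power_add simp flip: of_nat_add)

lemma add_char_0: "add_char 0 = 1"
  using add_char_of_nat[of 0] by simp

lemma add_char_neq_1: "a \<in> Fp \<Longrightarrow> a \<noteq> 0 \<Longrightarrow> add_char a \<noteq> 1"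
  unfolding Fp_eq by (auto simp: add_char_of_nat zeta_pow_eq_1 of_nat_eq_0_iff_char_dvd CHAR_eq)

section \<open>Subspaces and orthogonality of characters\<close>

definition subspace :: "'a set \<Rightarrow> bool" where
  "subspace W \<longleftrightarrow> 0 \<in> W \<and> (\<forall>x\<in>W. \<forall>y\<in>W. x + y \<in> W) \<and> (\<forall>c\<in>Fp. \<forall>x\<in>W. c * x \<in> W)"

lemma subspace_UNIV: "subspace UNIV" and subspace_Fp: "subspace Fp"
  by (auto simp: subspace_def Fp_intros)

lemma subspace_add: "subspace W \<Longrightarrow> x \<in> W \<Longrightarrow> y \<in> W \<Longrightarrow> x + y \<in> W"
  and subspace_scale: "subspace W \<Longrightarrow> c \<in> Fp \<Longrightarrow> x \<in> W \<Longrightarrow> c * x \<in> W"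
  by (auto simp: subspace_def)

lemma subspace_diff: "subspace W \<Longrightarrow> x \<in> W \<Longrightarrow> y \<in> W \<Longrightarrow> x - y \<in> W"
  using subspace_add[of W x "- 1 * y"] subspace_scale[of W "- 1" y] Fp_uminus[OF Fp_1] by simp

text \<open>Translation by some \<open>z\<close> with \<open>h z \<noteq> 0\<close> permutes
  \<open>W\<close> and multiplies the sum by \<open>add_char (h z)\<close>, which is not 1; hence
  the sum vanishes.\<close>

lemma sum_add_char_hom:
  assumes W: "subspace W" and ran: "\<And>y. y \<in> W \<Longrightarrow> h y \<in> Fp"
    and add: "\<And>x y. x \<in> W \<Longrightarrow> y \<in> W \<Longrightarrow> h (x + y) = h x + h y"
  shows "(\<Sum>y\<in>W. add_char (h y)) = (if \<forall>y\<in>W. h y = 0 then of_nat (card W) else 0)"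
proof (cases "\<forall>y\<in>W. h y = 0")
  case True
  thus ?thesis by (simp add: add_char_0)
next
  case False
  then obtain z where z: "z \<in> W" "h z \<noteq> 0" by blast
  let ?S = "\<Sum>y\<in>W. add_char (h y)"
  have "?S = (\<Sum>y\<in>W. add_char (h (y + z)))"
    by (rule sum.reindex_bij_witness[of _ "\<lambda>y. y + z" "\<lambda>y. y - z"])
       (use z W in \<open>auto intro: subspace_add subspace_diff\<close>)
  also have "\<dots> = (\<Sum>y\<in>W. add_char (h y) * add_char (h z))"
    by (intro sum.cong refl) (simp add: add z add_char_add ran)
  also have "\<dots> = ?S * add_char (h z)" by (simp add: sum_distrib_right)
  finally have "?S * (1 - add_char (h z)) = 0" by (simp add: algebra_simps)
  moreover have "1 - add_char (h z) \<noteq> 0" using add_char_neq_1[OF ran] z by simp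
  ultimately show ?thesis using False by auto
qed

lemma sum_Fp_add_char: "c \<in> Fp \<Longrightarrow> (\<Sum>y\<in>Fp. add_char (c * y)) = (if c = 0 then of_nat p else 0)"
  using sum_add_char_hom[OF subspace_Fp, of "\<lambda>y. c * y"] Fp_1
  by (auto simp: Fp_mult distrib_left card_Fp)

section \<open>The trace\<close>

abbreviation tr :: "'a \<Rightarrow> 'a" where "tr \<equiv> field_trace p m"

lemma tr_Fp: "tr x \<in> Fp"
proof -
  have "tr x = of_nat (prime_field_residue (tr x))" "prime_field_residue (tr x) < p"
    using of_nat_residue_trace[OF prime_p card_field] by auto
  thus ?thesis unfolding Fp_eq by (metis image_eqI lessThan_iff)
qed

lemma tr_add: "tr (x + y) = tr x + tr y"
  by (simp add: field_trace_def frob_add sum.distrib)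

lemma tr_scale: "c \<in> Fp \<Longrightarrow> tr (c * x) = c * tr x"
  by (simp add: field_trace_def power_mult_distrib Fp_frob sum_distrib_left)

lemma tr_0: "tr 0 = 0"
  using tr_scale[of 0 0] Fp_0 by simp

lemma tr_frob: "tr (x ^ (p ^ j)) = tr x"
proof -
  have "tr (x ^ (p ^ j)) = (\<Sum>i<m. (x ^ (p ^ i)) ^ (p ^ j))"
    unfolding field_trace_def frob_comp by (simp add: add.commute)
  also have "\<dots> = tr x ^ (p ^ j)" by (simp add: field_trace_def frob_sum)
  finally show ?thesis by (simp add: Fp_frob tr_Fp)
qed

text \<open>Read as a polynomial, the trace is nonzero of degree \<open>p ^ (m - 1)\<close>, too
  small to vanish at all \<open>p ^ m\<close> elements.\<close>

lemma tr_nontrivial: "\<exists>x. tr x \<noteq> 0"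
proof (rule ccontr)
  assume "\<not> (\<exists>x. tr x \<noteq> 0)"
  hence all: "tr x = 0" for x by blast
  have m0: "m > 0"
  proof (rule ccontr)
    assume "\<not> m > 0"
    hence "CARD('a) = 1" using card_field by simp
    thus False using card_mono[of UNIV "{0, 1 :: 'a}"] by simp
  qed
  define f :: "'a poly" where "f = (\<Sum>i<m. monom 1 (p ^ i))"
  have inj: "p ^ i = p ^ j \<longleftrightarrow> i = j" for i j
    using p_gt_2 by (simp add: power_inject_exp)
  have "coeff f (p ^ (m - 1)) = (\<Sum>i<m. if i = m - 1 then 1 else 0)"
    unfolding f_def coeff_sum coeff_monom by (intro sum.cong refl) (simp add: inj)
  also have "\<dots> = 1" using m0 by simp
  finally have f0: "f \<noteq> 0" by auto
  have deg: "degree f \<le> p ^ (m - 1)"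
    unfolding f_def
  proof (intro degree_sum_le)
    fix i assume "i \<in> {..<m}"
    hence "p ^ i \<le> p ^ (m - 1)" using p_gt_2 by (intro power_increasing) auto
    thus "degree (monom (1::'a) (p ^ i)) \<le> p ^ (m - 1)"
      using degree_monom_le order.trans by blast
  qed simp
  have "poly f x = 0" for x
    using all[of x] by (simp add: f_def field_trace_def poly_sum poly_monom)
  hence "{x. poly f x = 0} = UNIV" by auto
  hence "p ^ m \<le> p ^ (m - 1)"
    using card_poly_roots_bound[OF f0] deg unfolding card_field[symmetric] by simp
  thus False using m0 p_gt_2 by (simp add: power_le_imp_le_exp)
qed

lemma tr_nondegenerate: "(\<forall>y. tr (a * y) = 0) \<longleftrightarrow> a = 0"
proof
  assume *: "\<forall>y. tr (a * y) = 0"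
  show "a = 0"
  proof (rule ccontr)
    assume "a \<noteq> 0"
    obtain x where "tr x \<noteq> 0" using tr_nontrivial by blast
    thus False using *[rule_format, of "x / a"] \<open>a \<noteq> 0\<close> by simp
  qed
qed (simp add: tr_0)

lemma sum_tr_add_char:
  "(\<Sum>y\<in>UNIV. add_char (tr (a * y))) = (if a = 0 then of_nat (p ^ m) else 0)"
  using sum_add_char_hom[OF subspace_UNIV, of "\<lambda>y. tr (a * y)"]
  by (simp add: tr_Fp distrib_left tr_add tr_nondegenerate card_field)

section \<open>The quadratic character of the prime field\<close>

abbreviation half :: nat where "half \<equiv> (p - 1) div 2"

text \<open>On \<open>Fp\<close> this is the Legendre symbol, defined through Euler's criterion so
  that multiplicativity is immediate. Its connection with squares is
  \<open>quad_char_eq_1_iff\<close>.\<close>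

definition quad_char :: "'a \<Rightarrow> complex" where
  "quad_char a = (if a = 0 then 0 else if a ^ half = 1 then 1 else - 1)"

lemma two_half: "2 * half = p - 1"
  using odd_p by simp

lemma half_pos: "half > 0"
  using p_gt_2 by simp

lemma Fp_pow_half:
  assumes "a \<in> Fp" "a \<noteq> 0"
  shows "a ^ half = 1 \<or> a ^ half = - 1"
proof -
  have "a * a ^ (p - 1) = a"
    using assms(1) p_gt_2 unfolding Fp_def by (simp flip: power_Suc)
  hence "a ^ (2 * half) = 1" unfolding two_half using assms(2) by simp
  hence "(a ^ half) ^ 2 = 1" by (simp add: power_mult mult.commute[of 2])
  thus ?thesis by (simp add: power2_eq_1_iff)
qed

lemma one_neq_minus_one: "(1 :: 'a) \<noteq> - 1"
  using neg_eq_self_iff[of 1] by auto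

lemma quad_char_0: "quad_char 0 = 0" and quad_char_1: "quad_char 1 = 1"
  by (simp_all add: quad_char_def)

lemma quad_char_mult:
  assumes "a \<in> Fp" "b \<in> Fp"
  shows "quad_char (a * b) = quad_char a * quad_char b"
proof (cases "a = 0 \<or> b = 0")
  case False
  thus ?thesis
    using Fp_pow_half[OF assms(1)] Fp_pow_half[OF assms(2)] one_neq_minus_one
    unfolding quad_char_def power_mult_distrib by auto
qed (auto simp: quad_char_def)

lemma quad_char_nonzero: "a \<noteq> 0 \<Longrightarrow> quad_char a = 1 \<or> quad_char a = - 1"
  by (auto simp: quad_char_def)

lemma quad_char_minus_1: "quad_char (- 1) = (- 1) ^ half"
  using one_neq_minus_one by (cases "even half") (simp_all add: quad_char_def)

text \<open>These elements are roots of \<open>X ^ half - 1\<close>. Compared with the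
  \<open>2 * half\<close> nonzero elements the bound yields a nonsquare; compared with the number of
  squares it yields Euler's criterion.\<close>

lemma card_quad_char_1_le: "card {a \<in> Fp. quad_char a = 1} \<le> half"
proof -
  define f :: "'a poly" where "f = monom 1 half - 1"
  have "coeff f half = 1" using half_pos by (simp add: f_def)
  hence f0: "f \<noteq> 0" by auto
  have deg: "degree f \<le> half"
    unfolding f_def by (intro degree_diff_le degree_monom_le) simp
  have "{a \<in> Fp. quad_char a = 1} \<subseteq> {a. poly f a = 0}"
    by (auto simp: f_def poly_monom quad_char_def split: if_splits)
  hence "card {a \<in> Fp. quad_char a = 1} \<le> card {a. poly f a = 0}"
    by (intro card_mono) auto
  thus ?thesis using card_poly_roots_bound[OF f0] deg by linarith
qed

lemma ex_nonsquare: "\<exists>a\<in>Fp. quad_char a = - 1"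
proof (rule ccontr)
  assume *: "\<not> ?thesis"
  have "Fp - {0} \<subseteq> {a \<in> Fp. quad_char a = 1}"
    using * quad_char_nonzero by auto
  hence "card (Fp - {0}) \<le> half"
    using card_quad_char_1_le card_mono[of "{a \<in> Fp. quad_char a = 1}" "Fp - {0}"] by simp
  moreover have "card (Fp - {0}) = 2 * half"
    unfolding two_half using card_Fp Fp_0 by simp
  ultimately show False using half_pos by linarith
qed

text \<open>Squaring is at most two-to-one, so there are at least \<open>half\<close> nonzero
  squares. They all have character 1, and at most \<open>half\<close> elements do.\<close>

lemma quad_char_eq_1_iff: "a \<in> Fp \<Longrightarrow> quad_char a = 1 \<longleftrightarrow> (\<exists>b\<in>Fp. b \<noteq> 0 \<and> a = b ^ 2)"
proof -
  assume a: "a \<in> Fp"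
  let ?S = "(\<lambda>b. b ^ 2) ` (Fp - {0})" and ?T = "{a \<in> Fp. quad_char a = 1}"
  have sub: "?S \<subseteq> ?T"
  proof safe
    fix b assume b: "b \<in> Fp" "b \<noteq> 0"
    show "b ^ 2 \<in> Fp" using b by (intro Fp_power)
    show "quad_char (b ^ 2) = 1"
      using quad_char_mult[OF b(1) b(1)] quad_char_nonzero[OF b(2)] by (auto simp: power2_eq_square)
  qed
  have "Fp - {0} \<subseteq> (\<Union>s\<in>?S. {b. b ^ 2 = s})" by auto
  hence "card (Fp - {0}) \<le> card (\<Union>s\<in>?S. {b. b ^ 2 = s})"
    by (intro card_mono) auto
  also have "\<dots> \<le> (\<Sum>s\<in>?S. card {b. b ^ 2 = s})" by (rule card_UN_le) simp
  also have "\<dots> \<le> (\<Sum>s\<in>?S. 2)"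
  proof (rule sum_mono)
    fix s assume "s \<in> ?S"
    then obtain c where "s = c ^ 2" by blast
    hence "{b. b ^ 2 = s} = {c, - c}" by (auto simp: power2_eq_iff)
    thus "card {b. b ^ 2 = s} \<le> 2" by (simp add: card_insert_if)
  qed
  finally have "p - 1 \<le> 2 * card ?S" using card_Fp Fp_0 by simp
  hence "half \<le> card ?S" by linarith
  hence "?S = ?T" using sub card_quad_char_1_le by (intro card_seteq) auto
  hence "quad_char a = 1 \<longleftrightarrow> a \<in> ?S" using a by auto
  also have "\<dots> \<longleftrightarrow> (\<exists>b\<in>Fp. b \<noteq> 0 \<and> a = b ^ 2)" by auto
  finally show ?thesis .
qed

lemma card_sqrt_Fp:
  assumes s: "s \<in> Fp"
  shows "of_nat (card {c \<in> Fp. c ^ 2 = s}) = 1 + quad_char s"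
proof (cases "s = 0")
  case True
  hence "{c \<in> Fp. c ^ 2 = s} = {0}" by (auto simp: Fp_0)
  thus ?thesis using True by (simp add: quad_char_0)
next
  case False
  show ?thesis
  proof (cases "quad_char s = 1")
    case True
    then obtain b where b: "b \<in> Fp" "b \<noteq> 0" "s = b ^ 2"
      using quad_char_eq_1_iff[OF s] by blast
    hence "{c \<in> Fp. c ^ 2 = s} = {b, - b}" by (auto simp: power2_eq_iff Fp_uminus)
    moreover have "b \<noteq> - b" using b(2) neg_eq_self_iff[of b] by auto
    ultimately show ?thesis using True by simp
  next
    case F: False
    hence "{c \<in> Fp. c ^ 2 = s} = {}"
      using quad_char_eq_1_iff[OF s] False by auto
    thus ?thesis using F quad_char_nonzero[OF False] by auto
  qed
qed

section \<open>Quadratic Gauss sums\<close>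

definition gauss :: complex where "gauss = (\<Sum>c\<in>Fp. add_char (c ^ 2))"

text \<open>Grouping the \<open>c\<close> by their square \<open>s\<close> gives the weight
  \<open>1 + quad_char s\<close>. The constant part sums to 0, and in the rest the substitution of
  \<open>a * s\<close> for \<open>s\<close> produces the factor \<open>quad_char a\<close>.\<close>

lemma gauss_scaled:
  assumes a: "a \<in> Fp" "a \<noteq> 0"
  shows "(\<Sum>c\<in>Fp. add_char (a * c ^ 2)) = quad_char a * gauss"
proof -
  have *: "(\<Sum>c\<in>Fp. add_char (b * c ^ 2)) = (\<Sum>s\<in>Fp. quad_char s * add_char (b * s))"
    if b: "b \<in> Fp" "b \<noteq> 0" for b
  proof -
    have "(\<Sum>c\<in>Fp. add_char (b * c ^ 2)) =
        (\<Sum>s\<in>Fp. \<Sum>c\<in>{c \<in> Fp. c ^ 2 = s}. add_char (b * c ^ 2))"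
      by (rule sum.group[symmetric]) (auto intro: Fp_power)
    also have "\<dots> = (\<Sum>s\<in>Fp. (1 + quad_char s) * add_char (b * s))"
      by (intro sum.cong refl) (simp flip: card_sqrt_Fp)
    also have "\<dots> = (\<Sum>s\<in>Fp. quad_char s * add_char (b * s))"
      using sum_Fp_add_char[OF b(1)] b(2) by (simp add: algebra_simps sum.distrib)
    finally show ?thesis .
  qed
  have "quad_char a * (\<Sum>c\<in>Fp. add_char (a * c ^ 2)) =
      (\<Sum>s\<in>Fp. quad_char (a * s) * add_char (a * s))"
    unfolding *[OF a] sum_distrib_left
    by (intro sum.cong refl) (simp add: quad_char_mult a)
  also have "\<dots> = (\<Sum>s\<in>Fp. quad_char s * add_char (1 * s))"
    by (rule sum.reindex_bij_witness[of _ "\<lambda>s. s / a" "\<lambda>s. a * s"])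
       (use a in \<open>auto intro: Fp_mult Fp_divide\<close>)
  also have "\<dots> = gauss" using *[OF Fp_1] by (simp add: gauss_def)
  finally show ?thesis using quad_char_nonzero[OF a(2)]
    by (auto simp: minus_equation_iff)
qed

text \<open>The factor \<open>quad_char (- 1)\<close> turns one copy of the sum into its conjugate,
  so the exponent is \<open>x ^ 2 - y ^ 2\<close>. With \<open>x = u + y\<close> it becomes linear
  in \<open>y\<close>, and only \<open>u = 0\<close> survives the summation over
  \<open>y\<close>.\<close>

lemma gauss_squared: "gauss ^ 2 = quad_char (- 1) * of_nat p"
proof -
  have "(quad_char (- 1) * gauss) * gauss =
      (\<Sum>y\<in>Fp. \<Sum>x\<in>Fp. add_char (x ^ 2 - y ^ 2))"
  proof -
    have "quad_char (- 1) * gauss = (\<Sum>y\<in>Fp. add_char (- 1 * y ^ 2))"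
      using gauss_scaled[OF Fp_uminus[OF Fp_1]] by simp
    hence "(quad_char (- 1) * gauss) * gauss =
        (\<Sum>y\<in>Fp. \<Sum>x\<in>Fp. add_char (- 1 * y ^ 2) * add_char (x ^ 2))"
      unfolding gauss_def by (simp only: sum_product)
    also have "\<dots> = (\<Sum>y\<in>Fp. \<Sum>x\<in>Fp. add_char (- 1 * y ^ 2 + x ^ 2))"
      by (intro sum.cong refl add_char_add[symmetric] Fp_intros)
    finally show ?thesis by simp
  qed
  also have "\<dots> = (\<Sum>y\<in>Fp. \<Sum>u\<in>Fp. add_char (u ^ 2 + (2 * u) * y))"
  proof (rule sum.cong[OF refl])
    fix y assume y: "y \<in> Fp"
    show "(\<Sum>x\<in>Fp. add_char (x ^ 2 - y ^ 2)) = (\<Sum>u\<in>Fp. add_char (u ^ 2 + (2 * u) * y))"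
      by (rule sum.reindex_bij_witness[of _ "\<lambda>u. u + y" "\<lambda>x. x - y"])
         (use y in \<open>auto intro: Fp_intros simp: power2_eq_square algebra_simps\<close>)
  qed
  also have "\<dots> = (\<Sum>u\<in>Fp. \<Sum>y\<in>Fp. add_char (u ^ 2 + (2 * u) * y))" by (rule sum.swap)
  also have "\<dots> = (\<Sum>u\<in>Fp. add_char (u ^ 2) * (\<Sum>y\<in>Fp. add_char ((2 * u) * y)))"
    unfolding sum_distrib_left by (intro sum.cong refl add_char_add Fp_intros)
  also have "\<dots> = (\<Sum>u\<in>Fp. if u = 0 then of_nat p else 0)"
    by (intro sum.cong refl) (auto simp: sum_Fp_add_char Fp_intros two_neq_0 add_char_0)
  also have "\<dots> = of_nat p" by (simp add: Fp_0)
  finally have "quad_char (- 1) * gauss ^ 2 = of_nat p" by (simp add: power2_eq_square mult.assoc)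
  thus ?thesis using quad_char_nonzero[of "- 1"] by (auto simp: minus_equation_iff)
qed

text \<open>The sign may stay undetermined: even powers depend only on \<open>gauss ^ 2\<close>, and
  a value containing an odd power is attained as often as its negative.\<close>

lemma gauss_eq: "gauss = sqrt_pstar p \<or> gauss = - sqrt_pstar p"
proof -
  have "gauss ^ 2 = sqrt_pstar p ^ 2"
    unfolding sqrt_pstar_squared[OF odd_p] gauss_squared quad_char_minus_1 by (simp add: pstar_def)
  thus ?thesis by (simp add: power2_eq_iff)
qed

section \<open>Exponential sums of quadratic forms\<close>

definition radical :: "('a \<Rightarrow> 'a \<Rightarrow> 'a) \<Rightarrow> 'a set \<Rightarrow> 'a set" where
  "radical B W = {x \<in> W. \<forall>y\<in>W. B x y = 0}"

text \<open>
  Splitting off a non-isotropic vector repeatedly diagonalises the form, and each split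
  contributes one Gauss sum; what remains in the end is the radical.
\<close>
lemma quadratic_form_sum:
  fixes B :: "'a \<Rightarrow> 'a \<Rightarrow> 'a"
  assumes ran: "\<And>x y. B x y \<in> Fp" and sym: "\<And>x y. B x y = B y x"
    and add: "\<And>x y z. B (x + y) z = B x z + B y z"
    and scale: "\<And>c x y. c \<in> Fp \<Longrightarrow> B (c * x) y = c * B x y"
    and W: "subspace W"
  shows "\<exists>r \<epsilon>. \<epsilon> \<in> {1, - 1} \<and> card W = p ^ r * card (radical B W) \<and>
    (\<forall>l\<in>Fp - {0}. (\<Sum>x\<in>W. add_char (l * B x x)) =
      \<epsilon> * (quad_char l * gauss) ^ r * of_nat (card (radical B W)))"
  using W
proof (induction "card W" arbitrary: W rule: less_induct)
  case less
  have add': "B x (y + z) = B x y + B x z" for x y z using add sym by metis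
  have scale': "c \<in> Fp \<Longrightarrow> B x (c * y) = c * B x y" for c x y using scale sym by metis
  show ?case
  proof (cases "\<forall>x\<in>W. B x x = 0")
    case True
    \<comment> \<open>By polarisation, a symmetric form that vanishes on the diagonal is zero in odd
      characteristic; then \<open>W\<close> is its own radical.\<close>
    have "B x y = 0" if "x \<in> W" "y \<in> W" for x y
    proof -
      have "B (x + y) (x + y) = B x x + B y y + 2 * B x y"
        by (simp add: add add' sym[of y x])
      hence "2 * B x y = 0" using True that subspace_add[OF less.prems] by simp
      thus ?thesis using two_neq_0 by simp
    qed
    hence "radical B W = W" by (auto simp: radical_def)
    moreover have "(\<Sum>x\<in>W. add_char (l * B x x)) = of_nat (card W)" for l
      using True by (simp add: add_char_0)
    ultimately show ?thesis by (intro exI[of _ 0] exI[of _ 1]) simp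
  next
    case False
    then obtain v where v: "v \<in> W" "B v v \<noteq> 0" by blast
    define V where "V = {w \<in> W. B v w = 0}"
    have V: "subspace V"
      using less.prems scale'[OF Fp_0, of v] unfolding subspace_def V_def
      by (auto simp: add' scale')
    have "V \<subset> W" using v by (auto simp: V_def)
    hence "card V < card W" by (intro psubset_card_mono) auto
    from less.hyps[OF this V] obtain r \<epsilon> where IH: "\<epsilon> \<in> {1, - 1}"
      "card V = p ^ r * card (radical B V)"
      "\<And>l. l \<in> Fp - {0} \<Longrightarrow> (\<Sum>x\<in>V. add_char (l * B x x)) =
        \<epsilon> * (quad_char l * gauss) ^ r * of_nat (card (radical B V))"
      by auto
    let ?c = "\<lambda>x. B v x / B v v"
    have c: "?c x \<in> Fp" for x by (intro Fp_divide ran)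
    have Bdiff: "B v (x - ?c x * v) = 0" for x
    proof -
      have "B v x = B v ((x - ?c x * v) + ?c x * v)" by simp
      also have "\<dots> = B v (x - ?c x * v) + ?c x * B v v" unfolding add' scale'[OF c] ..
      finally show ?thesis using v by simp
    qed
    have proj: "x - ?c x * v \<in> V" if "x \<in> W" for x
      unfolding V_def using Bdiff
      by (intro CollectI conjI subspace_diff[OF less.prems] subspace_scale[OF less.prems] c v that)
    have bij: "bij_betw (\<lambda>(c, w). c * v + w) (Fp \<times> V) W"
    proof (rule bij_betw_byWitness[where f' = "\<lambda>x. (?c x, x - ?c x * v)"])
      show "\<forall>a\<in>Fp \<times> V. (\<lambda>x. (?c x, x - ?c x * v)) ((\<lambda>(c, w). c * v + w) a) = a"
        using v by (auto simp: V_def add' scale')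
      show "(\<lambda>(c, w). c * v + w) ` (Fp \<times> V) \<subseteq> W"
        using less.prems v by (auto simp: V_def intro!: subspace_add subspace_scale)
      show "(\<lambda>x. (?c x, x - ?c x * v)) ` W \<subseteq> Fp \<times> V"
        using c proj by blast
    qed auto
    have cardW: "card W = p * card V"
      using bij_betw_same_card[OF bij] by (simp add: card_cartesian_product card_Fp)
    have rad: "radical B V = radical B W"
    proof (intro equalityI subsetI)
      fix x assume x: "x \<in> radical B V"
      have "B x y = 0" if y: "y \<in> W" for y
      proof -
        have "B x (y - ?c y * v) = 0" using x proj[OF y] by (simp add: radical_def)
        moreover have "B x v = 0" using x sym by (simp add: radical_def V_def)
        moreover have "B x y = B x (y - ?c y * v) + ?c y * B x v"
          using add'[of x "y - ?c y * v" "?c y * v"] unfolding scale'[OF c] by simp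
        ultimately show ?thesis by simp
      qed
      thus "x \<in> radical B W" using x by (auto simp: radical_def V_def)
    next
      fix x assume "x \<in> radical B W"
      thus "x \<in> radical B V" using v sym[of v x] by (auto simp: radical_def V_def)
    qed
    \<comment> \<open>The new sign \<open>quad_char (B v v)\<close> does not depend on
      \<open>l\<close>; the scalar enters only as one factor \<open>quad_char l\<close> per split
      vector. One choice of \<open>r\<close> and \<open>\<epsilon>\<close> therefore serves all
      multiples of the form, which makes their sums comparable.\<close>
    have "(\<Sum>x\<in>W. add_char (l * B x x)) =
        quad_char (B v v) * \<epsilon> * (quad_char l * gauss) ^ Suc r * of_nat (card (radical B W))"
      if l: "l \<in> Fp - {0}" for l
    proof -
      have "(\<Sum>x\<in>W. add_char (l * B x x)) =
          (\<Sum>(c, w)\<in>Fp \<times> V. add_char (l * B (c * v + w) (c * v + w)))"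
        using sum.reindex_bij_betw[OF bij, of "\<lambda>x. add_char (l * B x x)"]
        by (simp add: case_prod_unfold)
      also have "\<dots> = (\<Sum>(c, w)\<in>Fp \<times> V. add_char (l * B v v * c ^ 2) * add_char (l * B w w))"
      proof (intro sum.cong refl, clarify)
        fix c w assume cw: "c \<in> Fp" "w \<in> V"
        have "l * B (c * v + w) (c * v + w) = l * B v v * c ^ 2 + l * B w w"
          using cw sym[of w v] by (simp add: add add' scale scale' V_def power2_eq_square algebra_simps)
        thus "add_char (l * B (c * v + w) (c * v + w)) =
            add_char (l * B v v * c ^ 2) * add_char (l * B w w)"
          using l cw by (simp add: add_char_add Fp_mult Fp_power ran)
      qed
      also have "\<dots> = (\<Sum>c\<in>Fp. add_char (l * B v v * c ^ 2)) * (\<Sum>w\<in>V. add_char (l * B w w))"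
        by (simp add: sum_product sum.cartesian_product)
      also have "(\<Sum>c\<in>Fp. add_char (l * B v v * c ^ 2)) = quad_char (l * B v v) * gauss"
        using l v by (intro gauss_scaled Fp_mult ran) auto
      also have "quad_char (l * B v v) = quad_char l * quad_char (B v v)"
        using l by (intro quad_char_mult ran) auto
      finally show ?thesis unfolding IH(3)[OF l] rad by (simp add: mult_ac)
    qed
    moreover have "quad_char (B v v) * \<epsilon> \<in> {1, - 1}"
      using quad_char_nonzero[OF v(2)] IH(1) by auto
    moreover have "card W = p ^ Suc r * card (radical B W)"
      unfolding cardW IH(2) rad by simp
    ultimately show ?thesis by blast
  qed
qed

end

section \<open>The radical and the values of the sums\<close>

locale quadratic_family = odd_char_field p m ty
  for p m :: nat and ty :: "'a::finite_field itself" +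
  fixes k :: nat
  assumes odd_m: "odd m" and k_pos: "k > 0" and coprime_mk: "gcd m k = 1"
begin

section \<open>Consequences of the arithmetic of m and k\<close>

lemma frob_iterate:
  assumes "(x :: 'a) ^ (p ^ j) = x"
  shows "x ^ (p ^ (j * n)) = x"
proof (induction n)
  case (Suc n)
  have "x ^ (p ^ (j * Suc n)) = (x ^ (p ^ (j * n))) ^ (p ^ j)"
    unfolding frob_comp by (simp add: add.commute)
  thus ?case using Suc assms by simp
qed simp

text \<open>By Bezout a suitable iterate of the \<open>k\<close>-th Frobenius power is Frobenius
  itself, because \<open>m\<close>-fold Frobenius is the identity.\<close>

lemma fixed_field: "(x :: 'a) ^ (p ^ k) = x \<longleftrightarrow> x \<in> Fp"
proof
  assume fixed: "x ^ (p ^ k) = x"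
  obtain a b where ab: "k * a = m * b + 1"
    using bezout_nat[of k m] k_pos coprime_mk by (metis gcd.commute neq0_conv)
  have "x = x ^ (p ^ (k * a))" using frob_iterate[OF fixed] by simp
  also have "\<dots> = (x ^ (p ^ (m * b))) ^ (p ^ 1)" unfolding ab frob_comp ..
  also have "\<dots> = x ^ p" using frob_iterate[OF frob_m, of x b] by simp
  finally show "x \<in> Fp" by (simp add: Fp_def)
qed (rule Fp_frob)

text \<open>A square root outside the prime field would generate a quadratic extension, impossible
  inside an extension of odd degree. Concretely, Frobenius would negate \<open>c\<close>, and
  applying it \<open>m\<close> times would give \<open>c = - c\<close>.\<close>

lemma nonsquare_ext:
  assumes l: "l \<in> Fp" "quad_char l = - 1"
  shows "l \<noteq> c ^ 2"
proof
  assume lc: "l = c ^ 2"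
  have "(c ^ p) ^ 2 = c ^ 2"
    using l(1) unfolding lc Fp_def by (simp add: power_mult[symmetric] mult.commute)
  hence "c ^ p = c \<or> c ^ p = - c" by (simp add: power2_eq_iff)
  thus False
  proof
    assume "c ^ p = c"
    hence "c \<in> Fp" by (simp add: Fp_def)
    moreover have "c \<noteq> 0" using l lc by (auto simp: quad_char_0)
    ultimately have "quad_char l = 1" using quad_char_eq_1_iff[OF l(1)] lc by blast
    thus False using l by simp
  next
    assume c: "c ^ p = - c"
    have "c ^ (p ^ j) = (- 1) ^ j * c" for j
    proof (induction j)
      case (Suc j)
      have "c ^ (p ^ Suc j) = (c ^ (p ^ j)) ^ p" by (simp only: power_Suc2 power_mult)
      also have "\<dots> = ((- 1) ^ j) ^ p * c ^ p" unfolding Suc power_mult_distrib ..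
      also have "((- 1 :: 'a) ^ j) ^ p = (- 1) ^ j" using odd_p by (cases "even j") auto
      finally show ?case using c by simp
    qed simp
    from this[of m] have "c = - c" using frob_m[of c] odd_m by simp
    hence "c = 0" using neg_eq_self_iff[of c] by simp
    thus False using l lc by (simp add: quad_char_0)
  qed
qed

text \<open>Abel summation. When the \<open>b i\<close> add up to 0 only differences of consecutive
  \<open>X j\<close> remain; for \<open>X j = x ^ (p ^ (k * j))\<close> these are Frobenius powers
  of \<open>x - x ^ (p ^ k)\<close>.\<close>

lemma sum_by_parts:
  fixes b X :: "nat \<Rightarrow> 'a"
  shows "(\<Sum>i\<le>d. b i * X i) =
    (\<Sum>j<d. (\<Sum>i\<le>j. b i) * (X j - X (Suc j))) + (\<Sum>i\<le>d. b i) * X d"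
  by (induction d) (auto simp: algebra_simps)

text \<open>
  A kernel element \<open>v\<close> allows one to factor \<open>x \<mapsto> f (v x)\<close> through \<open>x \<mapsto> x - \<sigma> x\<close>,
  where \<open>\<sigma>\<close> is the \<open>k\<close>-th power of the Frobenius map; the kernel of the latter is the prime field.
\<close>
lemma card_kernel_linearized:
  fixes a :: "nat \<Rightarrow> 'a"
  assumes "\<exists>i\<le>d. a i \<noteq> 0"
  shows "card {x. (\<Sum>i\<le>d. a i * x ^ (p ^ (k * i))) = 0} \<le> p ^ d"
  using assms
proof (induction d arbitrary: a)
  case 0
  hence "{x. (\<Sum>i\<le>0. a i * x ^ (p ^ (k * i))) = 0} = {0}" by auto
  thus ?case by simp
next
  case (Suc d)
  let ?K = "{x. (\<Sum>i\<le>Suc d. a i * x ^ (p ^ (k * i))) = 0}"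
  show ?case
  proof (cases "?K \<subseteq> {0}")
    case True
    hence "card ?K \<le> card {0 :: 'a}" by (intro card_mono) auto
    also have "\<dots> \<le> p ^ Suc d" using p_gt_2 by simp
    finally show ?thesis .
  next
    case False
    then obtain v where v: "v \<in> ?K" "v \<noteq> 0" by blast
    define b where "b i = a i * v ^ (p ^ (k * i))" for i
    define c where "c j = (\<Sum>i\<le>j. b i)" for j
    have bsum: "(\<Sum>i\<le>Suc d. b i) = 0" using v by (simp add: b_def)
    let ?G = "{x. (\<Sum>i\<le>d. c i * x ^ (p ^ (k * i))) = 0}"
    \<comment> \<open>The partial sums determine all \<open>b i\<close> (the last one through
      \<open>bsum\<close>), and each \<open>b i\<close> is \<open>a i\<close> times a nonzero
      factor.\<close>
    have "\<exists>i\<le>d. c i \<noteq> 0"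
    proof (rule ccontr)
      assume "\<not> (\<exists>i\<le>d. c i \<noteq> 0)"
      hence c0: "c i = 0" if "i \<le> d" for i using that by blast
      have b0: "b i = 0" if "i \<le> d" for i
      proof (cases i)
        case 0
        thus ?thesis using c0[of 0] by (simp add: c_def)
      next
        case (Suc j)
        have "c i = c j + b i" by (simp add: c_def Suc)
        thus ?thesis using c0[of i] c0[of j] that Suc by simp
      qed
      hence "b i = 0" if "i \<le> Suc d" for i
        using bsum that by (cases "i = Suc d") auto
      thus False using Suc.prems v by (auto simp: b_def)
    qed
    hence IH: "card ?G \<le> p ^ d" by (rule Suc.IH)
    have factor: "(\<Sum>i\<le>Suc d. a i * (v * x) ^ (p ^ (k * i))) =
        (\<Sum>i\<le>d. c i * (x - x ^ (p ^ k)) ^ (p ^ (k * i)))" for x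
    proof -
      have "(\<Sum>i\<le>Suc d. a i * (v * x) ^ (p ^ (k * i))) =
          (\<Sum>i\<le>Suc d. b i * x ^ (p ^ (k * i)))"
        by (simp only: b_def power_mult_distrib mult.assoc)
      also have "\<dots> = (\<Sum>j<Suc d. c j * (x ^ (p ^ (k * j)) - x ^ (p ^ (k * Suc j))))"
        using bsum unfolding sum_by_parts[where d = "Suc d"] by (simp add: c_def)
      also have "\<dots> = (\<Sum>j\<le>d. c j * (x - x ^ (p ^ k)) ^ (p ^ (k * j)))"
        by (simp only: lessThan_Suc_atMost frob_diff frob_comp mult_Suc_right)
      finally show ?thesis .
    qed
    have fiber: "card {x. x - x ^ (p ^ k) = y} \<le> p" for y :: 'a
    proof (cases "{x. x - x ^ (p ^ k) = y} = {}")
      case False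
      then obtain z where z: "z - z ^ (p ^ k) = y" by blast
      have "{x. x - x ^ (p ^ k) = y} \<subseteq> (\<lambda>c. z + c) ` Fp"
      proof safe
        fix x assume x: "y = x - x ^ (p ^ k)"
        have "x ^ (p ^ k) = x - y" "z ^ (p ^ k) = z - y" using x z by (simp_all add: algebra_simps)
        hence "(x - z) ^ (p ^ k) = x - z" unfolding frob_diff by simp
        hence "x - z \<in> Fp" by (simp only: fixed_field)
        thus "x \<in> (\<lambda>c. z + c) ` Fp" by (intro image_eqI[of _ _ "x - z"]) auto
      qed
      hence "card {x. x - x ^ (p ^ k) = y} \<le> card ((\<lambda>c. z + c) ` Fp)" by (intro card_mono) auto
      also have "\<dots> \<le> p" using card_image_le[of Fp "\<lambda>c. z + c"] by (simp add: card_Fp)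
      finally show ?thesis .
    qed simp
    have "?K \<subseteq> (\<lambda>x. v * x) ` (\<Union>y\<in>?G. {x. x - x ^ (p ^ k) = y})"
    proof
      fix x assume "x \<in> ?K"
      hence "(\<Sum>i\<le>Suc d. a i * (v * (x / v)) ^ (p ^ (k * i))) = 0" using v by simp
      hence "x / v - (x / v) ^ (p ^ k) \<in> ?G" unfolding factor by simp
      thus "x \<in> (\<lambda>x. v * x) ` (\<Union>y\<in>?G. {x. x - x ^ (p ^ k) = y})"
        using v by (intro image_eqI[of _ _ "x / v"]) auto
    qed
    hence "card ?K \<le> card ((\<lambda>x. v * x) ` (\<Union>y\<in>?G. {x. x - x ^ (p ^ k) = y}))"
      by (intro card_mono) auto
    also have "\<dots> \<le> card (\<Union>y\<in>?G. {x. x - x ^ (p ^ k) = y})" by (intro card_image_le) simp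
    also have "\<dots> \<le> (\<Sum>y\<in>?G. card {x. x - x ^ (p ^ k) = y})" by (intro card_UN_le) simp
    also have "\<dots> \<le> (\<Sum>y\<in>?G. p)" by (intro sum_mono fiber)
    also have "\<dots> \<le> p ^ Suc d" using IH by simp
    finally show ?thesis .
  qed
qed

section \<open>The sums as sums of quadratic forms\<close>

abbreviation T :: "'a \<Rightarrow> 'a \<Rightarrow> 'a \<Rightarrow> complex" where "T \<equiv> exp_sum_T p m k"

definition form :: "'a \<Rightarrow> 'a \<Rightarrow> 'a \<Rightarrow> 'a \<Rightarrow> 'a" where
  "form \<alpha> \<beta> \<gamma> x = \<alpha> * x ^ (p ^ (2 * k) + 1) + \<beta> * x ^ (p ^ k + 1) + \<gamma> * x ^ 2"

lemma T_eq: "T \<alpha> \<beta> \<gamma> = (\<Sum>x\<in>UNIV. add_char (tr (form \<alpha> \<beta> \<gamma> x)))"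
  unfolding exp_sum_T_def add_char_def form_def ..

definition polar :: "'a \<Rightarrow> 'a \<Rightarrow> 'a \<Rightarrow> 'a \<Rightarrow> 'a \<Rightarrow> 'a" where
  "polar \<alpha> \<beta> \<gamma> x y = \<alpha> * (x ^ (p ^ (2 * k)) * y + x * y ^ (p ^ (2 * k)))
     + \<beta> * (x ^ (p ^ k) * y + x * y ^ (p ^ k)) + \<gamma> * (2 * x * y)"

lemma polar_sym: "polar \<alpha> \<beta> \<gamma> x y = polar \<alpha> \<beta> \<gamma> y x"
  by (simp add: polar_def algebra_simps)

lemma polar_add: "polar \<alpha> \<beta> \<gamma> (x + y) z = polar \<alpha> \<beta> \<gamma> x z + polar \<alpha> \<beta> \<gamma> y z"
  by (simp add: polar_def frob_add algebra_simps)

lemma polar_scale: "c \<in> Fp \<Longrightarrow> polar \<alpha> \<beta> \<gamma> (c * x) z = c * polar \<alpha> \<beta> \<gamma> x z"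
  by (simp add: polar_def power_mult_distrib Fp_frob algebra_simps)

lemma polar_diag: "polar \<alpha> \<beta> \<gamma> x x = 2 * form \<alpha> \<beta> \<gamma> x"
  by (simp add: polar_def form_def power2_eq_square algebra_simps)

lemma form_scale: "form (l * \<alpha>) (l * \<beta>) (l * \<gamma>) x = l * form \<alpha> \<beta> \<gamma> x"
  by (simp add: form_def algebra_simps)

text \<open>The trace is invariant under Frobenius, so every term may be raised to the power that
  makes \<open>y\<close> occur as \<open>y ^ (p ^ (2 * k))\<close>. The cofactor of that power is
  the \<sigma>-polynomial whose kernel contains the radical.\<close>

lemma tr_polar_radical:
  "tr (polar \<alpha> \<beta> \<gamma> x y) = tr (y ^ (p ^ (2 * k)) *
    (\<alpha> * x + \<beta> ^ (p ^ k) * x ^ (p ^ k) + 2 * \<gamma> ^ (p ^ (2 * k)) * x ^ (p ^ (2 * k))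
      + \<beta> ^ (p ^ (2 * k)) * x ^ (p ^ (3 * k)) + \<alpha> ^ (p ^ (2 * k)) * x ^ (p ^ (4 * k))))"
proof -
  have "tr (polar \<alpha> \<beta> \<gamma> x y) = tr (\<alpha> * x ^ (p ^ (2 * k)) * y) + tr (\<alpha> * x * y ^ (p ^ (2 * k)))
      + tr (\<beta> * x ^ (p ^ k) * y) + tr (\<beta> * x * y ^ (p ^ k)) + tr (2 * \<gamma> * x * y)"
    by (simp add: polar_def distrib_left distrib_right tr_add mult_ac)
  also have "tr (\<alpha> * x ^ (p ^ (2 * k)) * y) = tr ((\<alpha> * x ^ (p ^ (2 * k)) * y) ^ (p ^ (2 * k)))"
    by (simp only: tr_frob)
  also have "tr (\<beta> * x ^ (p ^ k) * y) = tr ((\<beta> * x ^ (p ^ k) * y) ^ (p ^ (2 * k)))"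
    by (simp only: tr_frob)
  also have "tr (\<beta> * x * y ^ (p ^ k)) = tr ((\<beta> * x * y ^ (p ^ k)) ^ (p ^ k))"
    by (simp only: tr_frob)
  also have "tr (2 * \<gamma> * x * y) = tr ((2 * \<gamma> * x * y) ^ (p ^ (2 * k)))"
    by (simp only: tr_frob)
  finally show ?thesis
    by (simp add: power_mult_distrib frob_comp Fp_frob[OF Fp_2] distrib_left tr_add mult_ac
        flip: mult_2)
qed

lemma card_radical:
  assumes "(\<alpha>, \<beta>, \<gamma>) \<noteq> (0, 0, 0)"
  shows "card {x. \<forall>y. tr (polar \<alpha> \<beta> \<gamma> x y) = 0} \<le> p ^ 4"
proof -
  define a :: "nat \<Rightarrow> 'a" where
    "a = (\<lambda>i. [\<alpha>, \<beta> ^ (p ^ k), 2 * \<gamma> ^ (p ^ (2 * k)), \<beta> ^ (p ^ (2 * k)), \<alpha> ^ (p ^ (2 * k))] ! i)"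
  have sum4: "(\<Sum>i\<le>4. f i) = f 0 + f 1 + f 2 + f 3 + f 4" for f :: "nat \<Rightarrow> 'a"
    by (simp add: numeral_eq_Suc)
  let ?L = "\<lambda>x. \<Sum>i\<le>4. a i * x ^ (p ^ (k * i))"
  have L: "tr (polar \<alpha> \<beta> \<gamma> x y) = tr (y ^ (p ^ (2 * k)) * ?L x)" for x y
    unfolding tr_polar_radical sum4 by (simp add: a_def mult.commute[of k])
  have "?L x = 0" if *: "\<forall>y. tr (polar \<alpha> \<beta> \<gamma> x y) = 0" for x
  proof -
    have "tr (?L x * y) = 0" for y
    proof -
      obtain z where "y = z ^ (p ^ (2 * k))" using frob_bij by (metis bij_pointE)
      thus ?thesis using * L by (simp add: mult.commute)
    qed
    thus ?thesis using tr_nondegenerate by blast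
  qed
  hence "card {x. \<forall>y. tr (polar \<alpha> \<beta> \<gamma> x y) = 0} \<le> card {x. ?L x = 0}"
    by (intro card_mono) auto
  also have "\<dots> \<le> p ^ 4"
  proof (rule card_kernel_linearized)
    have "a 0 \<noteq> 0 \<or> a 1 \<noteq> 0 \<or> a 2 \<noteq> 0"
      using assms two_neq_0 by (auto simp: a_def frob_eq_0)
    moreover have "(0 :: nat) \<le> 4" "(1 :: nat) \<le> 4" "(2 :: nat) \<le> 4" by simp_all
    ultimately show "\<exists>i\<le>4. a i \<noteq> 0" by blast
  qed
  finally show ?thesis .
qed

text \<open>The sign and the rank are common to all multiples \<open>l\<close>, so that in a product
  of two such sums the unknown sign cancels.\<close>

lemma T_value:
  obtains r \<epsilon> where "\<epsilon> \<in> {1, - 1}"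
    "p ^ m = p ^ r * card {x. \<forall>y. tr (polar \<alpha> \<beta> \<gamma> x y) = 0}"
    "\<And>l. l \<in> Fp \<Longrightarrow> l \<noteq> 0 \<Longrightarrow> T (l * \<alpha>) (l * \<beta>) (l * \<gamma>) =
       \<epsilon> * (quad_char l * gauss) ^ r * of_nat (card {x. \<forall>y. tr (polar \<alpha> \<beta> \<gamma> x y) = 0})"
proof -
  \<comment> \<open>Half the polar form, so that the diagonal \<open>B x x\<close> is the trace of
    the form itself.\<close>
  define B where "B x y = tr (polar \<alpha> \<beta> \<gamma> x y) / 2" for x y
  have rad: "radical B UNIV = {x. \<forall>y. tr (polar \<alpha> \<beta> \<gamma> x y) = 0}"
    using two_neq_0 by (simp add: radical_def B_def)
  have B_diag: "B x x = tr (form \<alpha> \<beta> \<gamma> x)" for x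
    using two_neq_0 by (simp add: B_def polar_diag tr_scale[OF Fp_2])
  have "\<exists>r \<epsilon>. \<epsilon> \<in> {1, - 1} \<and> CARD('a) = p ^ r * card (radical B UNIV) \<and>
    (\<forall>l\<in>Fp - {0}. (\<Sum>x\<in>UNIV. add_char (l * B x x)) =
      \<epsilon> * (quad_char l * gauss) ^ r * of_nat (card (radical B UNIV)))"
  proof (rule quadratic_form_sum)
    show "B x y \<in> Fp" for x y unfolding B_def by (intro Fp_divide tr_Fp Fp_2)
    show "B x y = B y x" for x y unfolding B_def by (subst polar_sym) simp
    show "B (x + y) z = B x z + B y z" for x y z
      by (simp add: B_def polar_add tr_add add_divide_distrib)
    show "B (c * x) y = c * B x y" if "c \<in> Fp" for c x y
      using that by (simp add: B_def polar_scale tr_scale)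
  qed (rule subspace_UNIV)
  then obtain r \<epsilon> where *: "\<epsilon> \<in> {1, - 1}" "CARD('a) = p ^ r * card (radical B UNIV)"
    "\<And>l. l \<in> Fp - {0} \<Longrightarrow> (\<Sum>x\<in>UNIV. add_char (l * B x x)) =
      \<epsilon> * (quad_char l * gauss) ^ r * of_nat (card (radical B UNIV))" by blast
  show thesis
  proof (rule that[of \<epsilon> r])
    fix l assume l: "l \<in> Fp" "l \<noteq> 0"
    have "T (l * \<alpha>) (l * \<beta>) (l * \<gamma>) = (\<Sum>x\<in>UNIV. add_char (l * B x x))"
      unfolding T_eq form_scale B_diag tr_scale[OF l(1)] ..
    thus "T (l * \<alpha>) (l * \<beta>) (l * \<gamma>) =
       \<epsilon> * (quad_char l * gauss) ^ r * of_nat (card {x. \<forall>y. tr (polar \<alpha> \<beta> \<gamma> x y) = 0})"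
      using *(3) l rad by simp
  qed (use * rad card_field in auto)
qed

text \<open>Here \<open>i\<close> is the dimension of the radical and \<open>m - i\<close> the rank;
  the bound on \<open>i\<close> is the kernel bound for \<sigma>-polynomials.\<close>

lemma T_classification:
  assumes "(\<alpha>, \<beta>, \<gamma>) \<noteq> (0, 0, 0)"
  obtains i \<epsilon> where "i \<le> 4" "i \<le> m" "\<epsilon> \<in> {1, - 1}"
    "\<And>l. l \<in> Fp \<Longrightarrow> l \<noteq> 0 \<Longrightarrow> T (l * \<alpha>) (l * \<beta>) (l * \<gamma>) =
       \<epsilon> * (quad_char l * gauss) ^ (m - i) * of_nat p ^ i"
proof -
  let ?R = "card {x. \<forall>y. tr (polar \<alpha> \<beta> \<gamma> x y) = 0}"
  obtain r \<epsilon> where *: "\<epsilon> \<in> {1, - 1}" "p ^ m = p ^ r * ?R"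
    "\<And>l. l \<in> Fp \<Longrightarrow> l \<noteq> 0 \<Longrightarrow> T (l * \<alpha>) (l * \<beta>) (l * \<gamma>) =
       \<epsilon> * (quad_char l * gauss) ^ r * of_nat ?R"
    by (rule T_value[where \<alpha> = \<alpha> and \<beta> = \<beta> and \<gamma> = \<gamma>]) blast
  have "p ^ r dvd p ^ m" using *(2) by simp
  hence rm: "r \<le> m" using p_gt_2 by (simp add: power_dvd_imp_le)
  hence "p ^ m = p ^ r * p ^ (m - r)" by (simp flip: power_add)
  hence R: "?R = p ^ (m - r)" using *(2) p_gt_2 by simp
  hence "p ^ (m - r) \<le> p ^ 4" using card_radical[OF assms] by simp
  hence "m - r \<le> 4" using p_gt_2 by (simp add: power_le_imp_le_exp)
  thus thesis using that[of "m - r" \<epsilon>] *(1,3) R rm by simp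
qed

lemma T_0: "T 0 0 0 = of_nat p ^ m"
  by (simp add: T_eq form_def tr_0 add_char_0 card_field)

text \<open>The bilinear form \<open>2 * \<gamma> * x * y\<close> is nondegenerate under the trace.
  This explicit form of full rank later shows that corank 0 occurs, where positivity is not visible
  from \<open>freq0\<close>.\<close>

lemma T_square_part:
  assumes "\<gamma> \<noteq> 0"
  obtains \<epsilon> where "\<epsilon> \<in> {1, - 1}" "T 0 0 \<gamma> = \<epsilon> * gauss ^ m"
proof -
  have rad: "{x. \<forall>y. tr (polar 0 0 \<gamma> x y) = 0} = {0}"
    using assms two_neq_0 tr_nondegenerate[of "\<gamma> * (2 * x)" for x]
    by (auto simp: polar_def mult.assoc tr_0)
  obtain r \<epsilon> where *: "\<epsilon> \<in> {1, - 1}" "p ^ m = p ^ r * (1 :: nat)"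
    "\<And>l. l \<in> Fp \<Longrightarrow> l \<noteq> 0 \<Longrightarrow> T (l * 0) (l * 0) (l * \<gamma>) =
       \<epsilon> * (quad_char l * gauss) ^ r * of_nat 1" by (rule T_value[of 0 0 \<gamma>, unfolded rad]) auto
  have "r = m" using *(2) p_gt_2 by simp
  thus thesis using that[of \<epsilon>] *(1) *(3)[OF Fp_1] by (simp add: quad_char_1)
qed

section \<open>Moments\<close>

abbreviation q :: nat where "q \<equiv> p ^ m"

abbreviation psi :: "'a \<Rightarrow> complex" where "psi x \<equiv> add_char (tr x)"

lemma psi_add: "psi (x + y) = psi x * psi y"
  by (simp add: tr_add add_char_add tr_Fp)

text \<open>For \<open>j\<close> in \<open>{0, k, 2 * k}\<close> these are the three monomials of
  the form, and \<open>bl j\<close> below is the polarisation of \<open>sq j\<close>. With the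
  exponent as a parameter the three equations of a moment become a single schema.\<close>

definition sq :: "nat \<Rightarrow> 'a \<Rightarrow> 'a" where "sq j x = x ^ (p ^ j) * x"

definition bl :: "nat \<Rightarrow> 'a \<Rightarrow> 'a \<Rightarrow> 'a" where "bl j x y = x ^ (p ^ j) * y + x * y ^ (p ^ j)"

lemma form_eq: "form \<alpha> \<beta> \<gamma> x = \<alpha> * sq (2 * k) x + \<beta> * sq k x + \<gamma> * sq 0 x"
  by (simp add: form_def sq_def power2_eq_square mult_ac)

lemma polar_eq: "polar \<alpha> \<beta> \<gamma> x y = \<alpha> * bl (2 * k) x y + \<beta> * bl k x y + \<gamma> * bl 0 x y"
  by (simp add: polar_def bl_def algebra_simps)

text \<open>The exponent is linear in each coefficient, so summing over \<open>\<alpha>\<close>,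
  \<open>\<beta>\<close> and \<open>\<gamma>\<close> detects the vanishing of the three functions by
  orthogonality, with a factor \<open>q\<close> each.\<close>

lemma sum_moment:
  fixes F :: "nat \<Rightarrow> 'b::finite \<Rightarrow> 'a"
  shows "(\<Sum>(\<alpha>, \<beta>, \<gamma>)\<in>UNIV. \<Sum>t\<in>UNIV. psi (\<alpha> * F (2 * k) t + \<beta> * F k t + \<gamma> * F 0 t)) =
    of_nat (q ^ 3 * card {t. \<forall>j\<in>{0, k, 2 * k}. F j t = 0})"
proof -
  let ?c = "\<lambda>a :: 'a. if a = 0 then of_nat q else (0 :: complex)"
  have "(\<Sum>(\<alpha>, \<beta>, \<gamma>)\<in>UNIV. \<Sum>t\<in>UNIV. psi (\<alpha> * F (2 * k) t + \<beta> * F k t + \<gamma> * F 0 t)) =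
      (\<Sum>t\<in>UNIV. \<Sum>(\<alpha>, \<beta>, \<gamma>)\<in>UNIV. psi (\<alpha> * F (2 * k) t + \<beta> * F k t + \<gamma> * F 0 t))"
    unfolding case_prod_unfold by (rule sum.swap)
  also have "\<dots> = (\<Sum>t\<in>UNIV. ?c (F (2 * k) t) * (?c (F k t) * ?c (F 0 t)))"
  proof (rule sum.cong[OF refl])
    fix t
    have "(\<Sum>(\<alpha>, \<beta>, \<gamma>)\<in>UNIV. psi (\<alpha> * F (2 * k) t + \<beta> * F k t + \<gamma> * F 0 t)) =
        (\<Sum>\<alpha>\<in>UNIV. psi (F (2 * k) t * \<alpha>)) *
        ((\<Sum>\<beta>\<in>UNIV. psi (F k t * \<beta>)) * (\<Sum>\<gamma>\<in>UNIV. psi (F 0 t * \<gamma>)))"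
      unfolding sum_UNIV_prod prod.case psi_add sum_distrib_right
      unfolding sum_distrib_left by (simp only: mult_ac)
    thus "(\<Sum>(\<alpha>, \<beta>, \<gamma>)\<in>UNIV. psi (\<alpha> * F (2 * k) t + \<beta> * F k t + \<gamma> * F 0 t)) =
        ?c (F (2 * k) t) * (?c (F k t) * ?c (F 0 t))"
      unfolding sum_tr_add_char .
  qed
  also have "\<dots> = (\<Sum>t\<in>UNIV. if \<forall>j\<in>{0, k, 2 * k}. F j t = 0 then of_nat (q ^ 3) else 0)"
    by (intro sum.cong refl) (auto simp: power3_eq_cube)
  also have "\<dots> = of_nat (q ^ 3 * card {t. \<forall>j\<in>{0, k, 2 * k}. F j t = 0})"
    by (simp add: sum.If_cases mult.commute)
  finally show ?thesis .
qed

lemma T_scaled: "T (l * \<alpha>) (l * \<beta>) (l * \<gamma>) = (\<Sum>x\<in>UNIV. psi (l * form \<alpha> \<beta> \<gamma> x))"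
  unfolding T_eq form_scale ..

text \<open>A difference of two values of the form is the polar form at \<open>u - v\<close> and
  \<open>(u + v) / 2\<close>, as for a difference of squares. The gain is that the new exponent is
  additive in \<open>y\<close>: after scaling to \<open>x = 1\<close> the equation for
  \<open>j = 0\<close> determines \<open>y\<close>.\<close>

lemma T_mult_conj: "T \<alpha> \<beta> \<gamma> * T (- \<alpha>) (- \<beta>) (- \<gamma>) = (\<Sum>x\<in>UNIV. \<Sum>y\<in>UNIV. psi (polar \<alpha> \<beta> \<gamma> x y))"
proof -
  define h :: 'a where "h = inverse 2"
  have h2: "2 * h = 1" using two_neq_0 unfolding h_def by (rule right_inverse)
  have half: "h \<in> Fp" using Fp_divide[OF Fp_1 Fp_2] unfolding h_def by (simp only: divide_inverse mult_1)
  have *: "polar \<alpha> \<beta> \<gamma> (u - v) (h * (u + v)) = form \<alpha> \<beta> \<gamma> u - form \<alpha> \<beta> \<gamma> v" for u v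
  proof -
    have "polar \<alpha> \<beta> \<gamma> (u - v) (h * (u + v)) = h * polar \<alpha> \<beta> \<gamma> (u + v) (u - v)"
      by (subst polar_sym) (rule polar_scale[OF half])
    also have "polar \<alpha> \<beta> \<gamma> (u + v) (u - v) = polar \<alpha> \<beta> \<gamma> u u - polar \<alpha> \<beta> \<gamma> v v"
      by (simp add: polar_def frob_diff frob_add algebra_simps)
    also have "h * \<dots> = form \<alpha> \<beta> \<gamma> u - form \<alpha> \<beta> \<gamma> v"
      unfolding polar_diag right_diff_distrib mult.assoc[symmetric] mult.commute[of h 2] h2 by simp
    finally show ?thesis .
  qed
  have bij: "bij_betw (\<lambda>(u, v). (u - v, h * (u + v))) UNIV (UNIV :: ('a \<times> 'a) set)"
  proof (rule bij_betw_byWitness[where f' = "\<lambda>(x, y). (y + h * x, y - h * x)"])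
    have hx: "h * x + h * x = x" for x
    proof -
      have "h * x + h * x = (2 * h) * x" by simp
      thus ?thesis unfolding h2 by simp
    qed
    have hxy: "h * (x + y) + h * (x - y) = x" "h * (x + y) - h * (x - y) = y" for x y
      using hx[of x] hx[of y] by (simp_all add: algebra_simps)
    have hxy': "(y + h * x) - (y - h * x) = x" "h * ((y + h * x) + (y - h * x)) = y" for x y
      using hx[of x] hx[of y] by (simp_all add: algebra_simps)
    thus "\<forall>a\<in>UNIV. (\<lambda>(x, y). (y + h * x, y - h * x))
        ((\<lambda>(u, v). (u - v, h * (u + v))) a) = (a :: 'a \<times> 'a)"
      and "\<forall>a\<in>UNIV. (\<lambda>(u, v). (u - v, h * (u + v)))
        ((\<lambda>(x, y). (y + h * x, y - h * x)) a) = (a :: 'a \<times> 'a)"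
      by (simp_all only: split_paired_All prod.case hxy hxy' simp_thms ball_UNIV)
  qed auto
  have "T \<alpha> \<beta> \<gamma> * T (- \<alpha>) (- \<beta>) (- \<gamma>) =
      (\<Sum>u\<in>UNIV. \<Sum>v\<in>UNIV. psi (form \<alpha> \<beta> \<gamma> u - form \<alpha> \<beta> \<gamma> v))"
  proof -
    have "T (- \<alpha>) (- \<beta>) (- \<gamma>) = (\<Sum>v\<in>UNIV. psi (- form \<alpha> \<beta> \<gamma> v))"
      using T_scaled[of "- 1" \<alpha> \<beta> \<gamma>] by simp
    thus ?thesis unfolding T_eq[of \<alpha>] by (simp only: sum_product psi_add[symmetric] diff_conv_add_uminus)
  qed
  also have "\<dots> = (\<Sum>(u, v)\<in>UNIV. psi (polar \<alpha> \<beta> \<gamma> (u - v) (h * (u + v))))"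
    unfolding sum_UNIV_prod * by simp
  also have "\<dots> = (\<Sum>(x, y)\<in>UNIV. psi (polar \<alpha> \<beta> \<gamma> x y))"
    using sum.reindex_bij_betw[OF bij, of "\<lambda>(x, y). psi (polar \<alpha> \<beta> \<gamma> x y)"]
    by (simp add: case_prod_unfold)
  finally show ?thesis by (simp add: sum_UNIV_prod)
qed

section \<open>Zeros of the homogeneous systems\<close>

lemma sq_0: "sq j 0 = 0" and bl_0: "bl j 0 y = 0" "bl j x 0 = 0"
  using frob_eq_0[of 0 j] by (simp_all add: sq_def bl_def)

lemma sq_zero: "sq 0 x = x ^ 2" and bl_zero: "bl 0 x y = 2 * x * y"
  by (simp_all add: sq_def bl_def power2_eq_square)

lemma sq_scale: "sq j (x * a) = sq j x * sq j a"
  and bl_scale: "bl j (x * a) (x * b) = sq j x * bl j a b"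
  by (simp_all add: sq_def bl_def power_mult_distrib algebra_simps)

lemma bl_scale_1: "bl j x (x * b) = sq j x * (b + b ^ (p ^ j))"
  by (simp add: sq_def bl_def power_mult_distrib algebra_simps)

lemma sq_eq_0: "sq j x = 0 \<longleftrightarrow> x = 0"
  by (auto simp: sq_def frob_eq_0)

text \<open>
  All equations below are homogeneous, so solutions whose first coordinate \<open>x\<close> is nonzero
  arise by scaling from those with \<open>x = 1\<close>.
\<close>
lemma card_homogeneous:
  fixes M :: "('a \<times> 'b::finite) set" and act :: "'a \<Rightarrow> 'b \<Rightarrow> 'b"
  assumes act: "\<And>x t. x \<noteq> 0 \<Longrightarrow> (x, act x t) \<in> M \<longleftrightarrow> t \<in> S"
    and bij: "\<And>x. x \<noteq> 0 \<Longrightarrow> bij (act x)"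
  shows "card M = card {t. (0, t) \<in> M} + (q - 1) * card S"
proof -
  have "card {t. (x, t) \<in> M} = card S" if "x \<noteq> 0" for x
  proof -
    have "{t. (x, t) \<in> M} = act x ` S"
      using act[OF that] bij[OF that] by (auto simp: image_iff) (metis bij_pointE)
    thus ?thesis using bij_is_inj[OF bij[OF that]] by (metis card_image inj_on_subset subset_UNIV)
  qed
  hence "(\<Sum>x\<in>UNIV - {0}. card {t. (x, t) \<in> M}) = (q - 1) * card S"
    by (simp add: card_field)
  thus ?thesis unfolding card_fibres[of M] by (subst sum.remove[of _ 0]) auto
qed

lemma bij_scale: "x \<noteq> 0 \<Longrightarrow> bij (\<lambda>a. x * a :: 'a)"
  by (rule bij_betw_byWitness[where f' = "\<lambda>a. a / x"]) auto

lemma bij_scale2: "x \<noteq> 0 \<Longrightarrow> bij (\<lambda>(a, b). (x * a :: 'a, x * b :: 'a))"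
  by (rule bij_betw_byWitness[where f' = "\<lambda>(a, b). (a / x, b / x)"]) auto

lemma bij_scale3: "x \<noteq> 0 \<Longrightarrow> bij (\<lambda>(a, b, c). (x * a :: 'a, x * b :: 'a, x * c :: 'a))"
  by (rule bij_betw_byWitness[where f' = "\<lambda>(a, b, c). (a / x, b / x, c / x)"]) auto

lemma card_axes: "card {(x :: 'a, y :: 'a). x = 0 \<or> y = 0} = 2 * q - 1"
proof -
  have "card {(x :: 'a, y :: 'a). x = 0 \<or> y = 0} =
      card {y. (0, y) \<in> {(x :: 'a, y :: 'a). x = 0 \<or> y = 0}} + (q - 1) * card {0 :: 'a}"
    by (rule card_homogeneous[where act = "\<lambda>x a. x * a"]) (auto simp: bij_scale)
  thus ?thesis using p_gt_2 by (simp add: card_field)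
qed

lemma bl_zeros: "{(x, y). \<forall>j\<in>{0, k, 2 * k}. bl j x y = 0} = {(x, y). x = 0 \<or> y = 0}"
  using two_neq_0 by (auto simp: bl_zero bl_0)

lemma nonsquare_anisotropic:
  assumes "l \<in> Fp" "quad_char l = - 1"
  shows "z ^ 2 = l * w ^ 2 \<longleftrightarrow> z = 0 \<and> w = 0"
proof
  assume *: "z ^ 2 = l * w ^ 2"
  have "w = 0"
  proof (rule ccontr)
    assume "w \<noteq> 0"
    hence "l = (z / w) ^ 2" using * by (simp add: power_divide)
    thus False using nonsquare_ext[OF assms] by blast
  qed
  thus "z = 0 \<and> w = 0" using * by simp
qed simp

text \<open>Once \<open>y\<close> has been eliminated, twice the equation for \<open>j = k\<close>
  is, up to sign, a combination of such squares, and each square vanishes exactly for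
  \<open>a \<in> Fp\<close>.\<close>

lemma frob_diff_sq: "(a ^ (p ^ k) - a) ^ 2 = (a ^ 2) ^ (p ^ k) - 2 * sq k a + (a :: 'a) ^ 2"
  by (simp add: power2_eq_square sq_def power_mult_distrib algebra_simps)

lemma add_frob_Fp: "y \<in> Fp \<Longrightarrow> y + y ^ (p ^ j) = 2 * y"
  by (simp add: Fp_frob)

lemma sq_Fp: "y \<in> Fp \<Longrightarrow> sq j y = y ^ 2"
  by (simp add: sq_def Fp_frob power2_eq_square)

text \<open>For \<open>x = 0\<close> the equation for \<open>j = 0\<close> gives
  \<open>z = 0\<close> and \<open>y\<close> is free. For \<open>x = 1\<close> it gives
  \<open>y = - (a ^ 2) / 2\<close>; then the equation for \<open>j = k\<close> reads
  \<open>(a ^ (p ^ k) - a) ^ 2 = 0\<close>, and every \<open>a \<in> Fp\<close> solves the whole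
  system.\<close>

lemma card_zeros3:
  "card {(x, y, z). \<forall>j\<in>{0, k, 2 * k}. bl j x y + sq j z = 0} = q + (q - 1) * p"
proof -
  let ?M = "{(x, y, z). \<forall>j\<in>{0, k, 2 * k}. bl j x y + sq j z = 0}"
  let ?S = "{(y, a). \<forall>j\<in>{0, k, 2 * k}. y + y ^ (p ^ j) + sq j a = 0}"
  have "card ?M = card {t. (0, t) \<in> ?M} + (q - 1) * card ?S"
  proof (rule card_homogeneous)
    fix x :: 'a and t :: "'a \<times> 'a" assume "x \<noteq> 0"
    thus "(x, (\<lambda>(a, b). (x * a, x * b)) t) \<in> ?M \<longleftrightarrow> t \<in> ?S"
      by (cases t) (simp add: bl_scale_1 sq_scale sq_eq_0 flip: distrib_left)
  qed (rule bij_scale2)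
  moreover have "{t. (0, t) \<in> ?M} = (\<lambda>y. (y, 0)) ` UNIV" by (auto simp: bl_0 sq_eq_0 sq_0)
  moreover have "?S = (\<lambda>a. (- (a ^ 2) / 2, a)) ` Fp"
  proof (intro equalityI subsetI)
    fix t assume "t \<in> ?S"
    then obtain y a where t: "t = (y, a)" and
      *: "2 * y + a ^ 2 = 0" "y + y ^ (p ^ k) + sq k a = 0" by (auto simp: sq_zero)
    have y: "y = - (a ^ 2) / 2" using *(1) two_neq_0 by (simp add: field_simps eq_neg_iff_add_eq_0)
    have "(2 * y) ^ (p ^ k) = - ((a ^ 2) ^ (p ^ k))"
      using *(1) frob_minus[of "a ^ 2" k] by (simp only: eq_neg_iff_add_eq_0[symmetric])
    hence "2 * y ^ (p ^ k) = - ((a ^ 2) ^ (p ^ k))" by (simp only: power_mult_distrib Fp_frob[OF Fp_2])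
    moreover have "2 * y + 2 * y ^ (p ^ k) + 2 * sq k a = 0" using *(2) by (metis distrib_left mult_zero_right)
    moreover have "2 * y = - (a ^ 2)" using *(1) by (simp add: eq_neg_iff_add_eq_0)
    ultimately have "(a ^ (p ^ k) - a) ^ 2 = 0" unfolding frob_diff_sq by (simp add: algebra_simps)
    hence "a \<in> Fp" by (simp add: fixed_field)
    thus "t \<in> (\<lambda>a. (- (a ^ 2) / 2, a)) ` Fp" using t y by blast
  next
    fix t assume "t \<in> (\<lambda>a. (- (a ^ 2) / 2, a)) ` Fp"
    then obtain a where a: "a \<in> Fp" "t = (- (a ^ 2) / 2, a)" by blast
    have "- (a ^ 2) / 2 \<in> Fp" using a by (intro Fp_intros)
    hence "- (a ^ 2) / 2 + (- (a ^ 2) / 2) ^ (p ^ j) + sq j a = 0" for j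
      unfolding sq_Fp[OF a(1)] by (subst add_frob_Fp) (use two_neq_0 in simp_all)
    thus "t \<in> ?S" unfolding a(2) by (simp only: mem_Collect_eq prod.case simp_thms ball_simps)
  qed
  ultimately show ?thesis
    by (simp add: card_image inj_on_def card_Fp card_field)
qed

text \<open>For \<open>x = 0\<close> what remains is \<open>y\<close> free and \<open>(z, w)\<close>
  on the axes. For \<open>x = 1\<close> one has \<open>y = - (a * c)\<close>, and the equation for
  \<open>j = k\<close> factors as \<open>(a ^ (p ^ k) - a) * (c ^ (p ^ k) - c) = 0\<close>, so only
  one of the two coordinates is forced into \<open>Fp\<close>.\<close>

lemma card_zeros4_hyperbolic:
  "card {(x, y, z, w). \<forall>j\<in>{0, k, 2 * k}. bl j x y + bl j z w = 0} =
    q * (2 * q - 1) + (q - 1) * (q ^ 2 - (q - p) ^ 2)"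
proof -
  let ?M = "{(x, y, z, w). \<forall>j\<in>{0, k, 2 * k}. bl j x y + bl j z w = 0}"
  let ?S = "{(y, a, c). \<forall>j\<in>{0, k, 2 * k}. y + y ^ (p ^ j) + bl j a c = 0}"
  have "card ?M = card {t. (0, t) \<in> ?M} + (q - 1) * card ?S"
  proof (rule card_homogeneous)
    fix x :: 'a and t :: "'a \<times> 'a \<times> 'a" assume "x \<noteq> 0"
    thus "(x, (\<lambda>(a, b, c). (x * a, x * b, x * c)) t) \<in> ?M \<longleftrightarrow> t \<in> ?S"
      by (cases t) (simp add: bl_scale_1 bl_scale sq_eq_0 flip: distrib_left)
  qed (rule bij_scale3)
  moreover have "{t. (0, t) \<in> ?M} = UNIV \<times> {(z, w). z = 0 \<or> w = 0}"
    unfolding bl_zeros[symmetric] by (auto simp: bl_0)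
  \<comment> \<open>The complement of \<open>(- Fp) \<times> (- Fp)\<close> is the set of pairs with
    at least one coordinate in \<open>Fp\<close>; this form makes its size a difference.\<close>
  moreover have S: "?S = (\<lambda>(a, c). (- a * c, a, c)) ` (- ((- Fp) \<times> (- Fp)))"
  proof (intro equalityI subsetI)
    fix t assume "t \<in> ?S"
    then obtain y a c where t: "t = (y, a, c)" and
      *: "2 * y + 2 * a * c = 0" "y + y ^ (p ^ k) + bl k a c = 0" by (auto simp: bl_zero)
    have "2 * (y + a * c) = 0" using *(1) by (simp only: distrib_left mult.assoc)
    hence "y + a * c = 0" using two_neq_0 by (simp only: mult_eq_0_iff simp_thms)
    hence y: "y = - (a * c)" by (simp add: eq_neg_iff_add_eq_0)
    have "- (a * c) + - (a ^ (p ^ k) * c ^ (p ^ k)) + bl k a c = 0"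
      using *(2) unfolding y frob_minus power_mult_distrib .
    hence "(a ^ (p ^ k) - a) * (c ^ (p ^ k) - c) = 0" by (simp add: bl_def algebra_simps)
    hence "a \<in> Fp \<or> c \<in> Fp" by (simp add: fixed_field)
    thus "t \<in> (\<lambda>(a, c). (- a * c, a, c)) ` (- ((- Fp) \<times> (- Fp)))" using t y by auto
  next
    fix t assume "t \<in> (\<lambda>(a, c). (- a * c, a, c)) ` (- ((- Fp) \<times> (- Fp)))"
    then obtain a c where ac: "a \<in> Fp \<or> c \<in> Fp" "t = (- (a * c), a, c)" by auto
    have "- (a * c) + (- (a * c)) ^ (p ^ j) + bl j a c = 0" for j
      unfolding frob_minus power_mult_distrib using ac(1)
      by (auto simp: bl_def Fp_frob algebra_simps)
    thus "t \<in> ?S" unfolding ac(2) by (simp only: mem_Collect_eq prod.case simp_thms ball_simps)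
  qed
  moreover have "card (- ((- Fp) \<times> (- Fp))) = q ^ 2 - (q - p) ^ 2"
  proof -
    have "card (- Fp) = q - p"
      by (simp add: Compl_eq_Diff_UNIV card_Diff_subset card_Fp card_field)
    thus ?thesis
      by (simp add: Compl_eq_Diff_UNIV[of "_ \<times> _"] card_Diff_subset card_cartesian_product
          card_field power2_eq_square)
  qed
  moreover have "inj_on (\<lambda>(a, c). (- a * c, a, c)) (- ((- Fp) \<times> (- Fp)))" by (auto simp: inj_on_def)
  ultimately show ?thesis
    by (simp only: card_image card_cartesian_product card_axes card_field)
qed

text \<open>Eliminating \<open>y\<close> leaves
  \<open>(a ^ (p ^ k) - a) ^ 2 = l * (b ^ (p ^ k) - b) ^ 2\<close>. As \<open>l\<close> is not a
  square, both sides vanish and both coordinates lie in \<open>Fp\<close>. For \<open>x = 0\<close>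
  the same anisotropy leaves only \<open>y\<close> free.\<close>

lemma card_zeros4_elliptic:
  assumes l: "l \<in> Fp" "quad_char l = - 1"
  shows "card {(x, y, z, w). \<forall>j\<in>{0, k, 2 * k}. bl j x y + sq j z - l * sq j w = 0} =
    q + (q - 1) * p ^ 2"
proof -
  let ?M = "{(x, y, z, w). \<forall>j\<in>{0, k, 2 * k}. bl j x y + sq j z - l * sq j w = 0}"
  let ?S = "{(y, a, b). \<forall>j\<in>{0, k, 2 * k}. y + y ^ (p ^ j) + sq j a - l * sq j b = 0}"
  have "card ?M = card {t. (0, t) \<in> ?M} + (q - 1) * card ?S"
  proof (rule card_homogeneous)
    fix x :: 'a and t :: "'a \<times> 'a \<times> 'a" assume x: "x \<noteq> 0"
    obtain y a b where t: "t = (y, a, b)" by (cases t)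
    have "bl j x (x * y) + sq j (x * a) - l * sq j (x * b) =
        sq j x * (y + y ^ (p ^ j) + sq j a - l * sq j b)" for j
      unfolding bl_scale_1 sq_scale by (simp add: algebra_simps)
    hence "bl j x (x * y) + sq j (x * a) - l * sq j (x * b) = 0 \<longleftrightarrow>
        y + y ^ (p ^ j) + sq j a - l * sq j b = 0" for j
      using x by (simp only: mult_eq_0_iff sq_eq_0 simp_thms)
    thus "(x, (\<lambda>(a, b, c). (x * a, x * b, x * c)) t) \<in> ?M \<longleftrightarrow> t \<in> ?S"
      unfolding t by (simp only: mem_Collect_eq prod.case)
  qed (rule bij_scale3)
  moreover have "{t. (0, t) \<in> ?M} = (\<lambda>y. (y, 0, 0)) ` UNIV"
    using nonsquare_anisotropic[OF l] by (auto simp: bl_0 sq_0 sq_zero)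
  moreover have S: "?S = (\<lambda>(a, b). ((l * b ^ 2 - (a ^ 2)) / 2, a, b)) ` (Fp \<times> Fp)"
  proof (intro equalityI subsetI)
    fix t assume "t \<in> ?S"
    then obtain y a b where t: "t = (y, a, b)" and
      *: "2 * y + a ^ 2 - l * b ^ 2 = 0" "y + y ^ (p ^ k) + sq k a - l * sq k b = 0"
      by (auto simp: sq_zero)
    have y2: "2 * y = l * b ^ 2 - (a ^ 2)" using *(1) by (simp add: algebra_simps)
    hence y: "y = (l * b ^ 2 - (a ^ 2)) / 2" using two_neq_0 by (simp add: eq_divide_eq mult.commute)
    have "(2 * y) ^ (p ^ k) = l * (b ^ 2) ^ (p ^ k) - (a ^ 2) ^ (p ^ k)"
      unfolding y2 frob_diff power_mult_distrib[of l] Fp_frob[OF l(1)] ..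
    hence y3: "2 * y ^ (p ^ k) = l * (b ^ 2) ^ (p ^ k) - (a ^ 2) ^ (p ^ k)"
      by (simp only: power_mult_distrib Fp_frob[OF Fp_2])
    have "0 = 2 * (y + y ^ (p ^ k) + sq k a - l * sq k b)" using *(2) by simp
    also have "\<dots> = 2 * y + 2 * y ^ (p ^ k) + 2 * sq k a - 2 * l * sq k b"
      by (simp add: algebra_simps)
    also have "\<dots> = l * (b ^ (p ^ k) - b) ^ 2 - (a ^ (p ^ k) - a) ^ 2"
      unfolding y2 y3 frob_diff_sq by (simp add: algebra_simps)
    finally have "(a ^ (p ^ k) - a) ^ 2 = l * (b ^ (p ^ k) - b) ^ 2" by simp
    hence "a \<in> Fp" "b \<in> Fp"
      unfolding nonsquare_anisotropic[OF l] by (simp_all add: fixed_field)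
    thus "t \<in> (\<lambda>(a, b). ((l * b ^ 2 - (a ^ 2)) / 2, a, b)) ` (Fp \<times> Fp)" using t y by auto
  next
    fix t assume "t \<in> (\<lambda>(a, b). ((l * b ^ 2 - (a ^ 2)) / 2, a, b)) ` (Fp \<times> Fp)"
    then obtain a b where ab: "a \<in> Fp" "b \<in> Fp" "t = ((l * b ^ 2 - a ^ 2) / 2, a, b)" by auto
    define y where "y = (l * b ^ 2 - a ^ 2) / 2"
    have y: "y \<in> Fp" "2 * y = l * b ^ 2 - a ^ 2"
      unfolding y_def using ab l two_neq_0 by (auto intro!: Fp_divide Fp_diff Fp_mult Fp_power Fp_2)
    have "y + y ^ (p ^ j) + sq j a - l * sq j b = 0" for j
      unfolding sq_Fp[OF ab(1)] sq_Fp[OF ab(2)] add_frob_Fp[OF y(1)] y(2) by simp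
    thus "t \<in> ?S" unfolding ab(3) y_def[symmetric] by (simp only: mem_Collect_eq prod.case simp_thms ball_simps)
  qed
  moreover have "inj_on (\<lambda>(a, b). ((l * b ^ 2 - (a ^ 2)) / 2, a, b)) (Fp \<times> Fp)"
    by (auto simp: inj_on_def)
  moreover have "inj (\<lambda>y :: 'a. (y, 0 :: 'a, 0 :: 'a))" by (auto simp: inj_on_def)
  ultimately show ?thesis
    by (simp only: card_image card_cartesian_product card_Fp card_field power2_eq_square)
qed

section \<open>Evaluation of the moments\<close>

lemma moment_T: "(\<Sum>(\<alpha>, \<beta>, \<gamma>)\<in>UNIV. T \<alpha> \<beta> \<gamma>) = of_nat (q ^ 3)"
proof -
  have "{x. \<forall>j\<in>{0, k, 2 * k}. sq j x = 0} = {0}" unfolding sq_eq_0 by auto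
  thus ?thesis unfolding T_eq form_eq sum_moment[of sq] by (simp only: card.insert card.empty finite.emptyI) simp
qed

lemma moment_T_conj:
  "(\<Sum>(\<alpha>, \<beta>, \<gamma>)\<in>UNIV. T \<alpha> \<beta> \<gamma> * T (- \<alpha>) (- \<beta>) (- \<gamma>)) = of_nat (q ^ 3 * (2 * q - 1))"
proof -
  define F where "F = (\<lambda>j (x, y). bl j x y)"
  have *: "T \<alpha> \<beta> \<gamma> * T (- \<alpha>) (- \<beta>) (- \<gamma>) =
      (\<Sum>t\<in>UNIV. psi (\<alpha> * F (2 * k) t + \<beta> * F k t + \<gamma> * F 0 t))" for \<alpha> \<beta> \<gamma>
    unfolding T_mult_conj sum_UNIV_prod polar_eq F_def prod.case ..
  have "{t. \<forall>j\<in>{0, k, 2 * k}. F j t = 0} = {(x, y). x = 0 \<or> y = 0}"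
    unfolding bl_zeros[symmetric] by (auto simp: F_def)
  thus ?thesis unfolding * sum_moment card_axes[symmetric] by simp
qed

lemma T_twist:
  "T (- (l * \<alpha>)) (- (l * \<beta>)) (- (l * \<gamma>)) = (\<Sum>w\<in>UNIV. psi (- l * form \<alpha> \<beta> \<gamma> w))"
  using T_scaled[of "- l" \<alpha> \<beta> \<gamma>] by simp

text \<open>The exponent is now \<open>z ^ 2 - l * w ^ 2\<close> in the coefficient of
  \<open>\<gamma>\<close>. It is anisotropic, so the origin is the only common zero, against
  \<open>2 * q - 1\<close> zeros without the twist.\<close>

lemma moment_T_twist:
  assumes l: "l \<in> Fp" "quad_char l = - 1"
  shows "(\<Sum>(\<alpha>, \<beta>, \<gamma>)\<in>UNIV. T \<alpha> \<beta> \<gamma> * T (- (l * \<alpha>)) (- (l * \<beta>)) (- (l * \<gamma>))) = of_nat (q ^ 3)"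
proof -
  define F where "F = (\<lambda>j (z, w). sq j z - l * sq j w)"
  have *: "T \<alpha> \<beta> \<gamma> * T (- (l * \<alpha>)) (- (l * \<beta>)) (- (l * \<gamma>)) =
      (\<Sum>t\<in>UNIV. psi (\<alpha> * F (2 * k) t + \<beta> * F k t + \<gamma> * F 0 t))" for \<alpha> \<beta> \<gamma>
    unfolding T_twist T_eq[of \<alpha>] sum_product sum_UNIV_prod psi_add[symmetric]
    by (intro sum.cong refl arg_cong[where f = psi]) (simp add: form_eq F_def algebra_simps)
  have "{t. \<forall>j\<in>{0, k, 2 * k}. F j t = 0} = {(0, 0)}"
    using nonsquare_anisotropic[OF l] by (auto simp: F_def sq_0 sq_zero)
  thus ?thesis unfolding * sum_moment by simp
qed

lemma moment_T3:
  "(\<Sum>(\<alpha>, \<beta>, \<gamma>)\<in>UNIV. T \<alpha> \<beta> \<gamma> * T (- \<alpha>) (- \<beta>) (- \<gamma>) * T \<alpha> \<beta> \<gamma>) =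
    of_nat (q ^ 3 * (q + (q - 1) * p))"
proof -
  define F where "F = (\<lambda>j (x, y, z). bl j x y + sq j z)"
  have *: "T \<alpha> \<beta> \<gamma> * T (- \<alpha>) (- \<beta>) (- \<gamma>) * T \<alpha> \<beta> \<gamma> =
      (\<Sum>t\<in>UNIV. psi (\<alpha> * F (2 * k) t + \<beta> * F k t + \<gamma> * F 0 t))" for \<alpha> \<beta> \<gamma>
    unfolding T_mult_conj unfolding T_eq[of \<alpha>] sum_distrib_right
    unfolding sum_distrib_left sum_UNIV_prod psi_add[symmetric]
    by (intro sum.cong refl arg_cong[where f = psi]) (simp add: form_eq polar_eq F_def algebra_simps)
  have "{t. \<forall>j\<in>{0, k, 2 * k}. F j t = 0} =
      {(x, y, z). \<forall>j\<in>{0, k, 2 * k}. bl j x y + sq j z = 0}" by (auto simp: F_def)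
  thus ?thesis unfolding * sum_moment card_zeros3[symmetric] by simp
qed

lemma moment_T4:
  "(\<Sum>(\<alpha>, \<beta>, \<gamma>)\<in>UNIV. (T \<alpha> \<beta> \<gamma> * T (- \<alpha>) (- \<beta>) (- \<gamma>)) * (T \<alpha> \<beta> \<gamma> * T (- \<alpha>) (- \<beta>) (- \<gamma>))) =
    of_nat (q ^ 3 * (q * (2 * q - 1) + (q - 1) * (q ^ 2 - (q - p) ^ 2)))"
proof -
  define F where "F = (\<lambda>j (x, y, z, w). bl j x y + bl j z w)"
  have *: "(T \<alpha> \<beta> \<gamma> * T (- \<alpha>) (- \<beta>) (- \<gamma>)) * (T \<alpha> \<beta> \<gamma> * T (- \<alpha>) (- \<beta>) (- \<gamma>)) =
      (\<Sum>t\<in>UNIV. psi (\<alpha> * F (2 * k) t + \<beta> * F k t + \<gamma> * F 0 t))" for \<alpha> \<beta> \<gamma>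
    unfolding T_mult_conj sum_distrib_right
    unfolding sum_distrib_left sum_UNIV_prod psi_add[symmetric]
    by (intro sum.cong refl arg_cong[where f = psi]) (simp add: polar_eq F_def algebra_simps)
  have "{t. \<forall>j\<in>{0, k, 2 * k}. F j t = 0} =
      {(x, y, z, w). \<forall>j\<in>{0, k, 2 * k}. bl j x y + bl j z w = 0}" by (auto simp: F_def)
  thus ?thesis unfolding * sum_moment card_zeros4_hyperbolic[symmetric] by simp
qed

text \<open>Exactly one of the two products is twisted: it contributes the parity sign
  \<open>(- 1) ^ Suc i\<close>, which would cancel if both were.\<close>

lemma moment_T4_twist:
  assumes l: "l \<in> Fp" "quad_char l = - 1"
  shows "(\<Sum>(\<alpha>, \<beta>, \<gamma>)\<in>UNIV. (T \<alpha> \<beta> \<gamma> * T (- \<alpha>) (- \<beta>) (- \<gamma>)) *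
      (T \<alpha> \<beta> \<gamma> * T (- (l * \<alpha>)) (- (l * \<beta>)) (- (l * \<gamma>)))) =
    of_nat (q ^ 3 * (q + (q - 1) * p ^ 2))"
proof -
  define F where "F = (\<lambda>j (x, y, z, w). bl j x y + sq j z - l * sq j w)"
  have *: "(T \<alpha> \<beta> \<gamma> * T (- \<alpha>) (- \<beta>) (- \<gamma>)) * (T \<alpha> \<beta> \<gamma> * T (- (l * \<alpha>)) (- (l * \<beta>)) (- (l * \<gamma>))) =
      (\<Sum>t\<in>UNIV. psi (\<alpha> * F (2 * k) t + \<beta> * F k t + \<gamma> * F 0 t))" for \<alpha> \<beta> \<gamma>
    unfolding T_mult_conj T_twist unfolding T_eq[of \<alpha>] sum_distrib_right
    unfolding sum_distrib_left sum_UNIV_prod psi_add[symmetric]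
    by (intro sum.cong refl arg_cong[where f = psi]) (simp add: form_eq polar_eq F_def algebra_simps)
  have "{t. \<forall>j\<in>{0, k, 2 * k}. F j t = 0} =
      {(x, y, z, w). \<forall>j\<in>{0, k, 2 * k}. bl j x y + sq j z - l * sq j w = 0}" by (auto simp: F_def)
  thus ?thesis unfolding * sum_moment card_zeros4_elliptic[OF l, symmetric] by simp
qed

section \<open>The value distribution\<close>

text \<open>The argument is the corank, and the absolute value is \<open>p\<close> to the power
  \<open>(m + i) / 2\<close>. For odd \<open>i\<close> the division is exact; for even
  \<open>i\<close> it rounds down, and the missing square root of \<open>p\<close> is the absolute
  value of \<open>sqrt_pstar p\<close>.\<close>

definition val :: "nat \<Rightarrow> complex" where
  "val i = (if even i then sqrt_pstar p else 1) * of_nat p ^ ((m + i) div 2)"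

lemma sign_power: "s \<in> {1, - 1 :: complex} \<Longrightarrow> s ^ n \<in> {1, - 1}"
  by (cases "even n") auto

lemma sign_mult: "s \<in> {1, - 1 :: complex} \<Longrightarrow> t \<in> {1, - 1} \<Longrightarrow> s * t \<in> {1, - 1}"
  by auto

lemma gauss_power_even: "\<exists>\<delta>\<in>{1, - 1}. gauss ^ (2 * h) = \<delta> * of_nat p ^ h"
proof -
  have "quad_char (- 1) \<in> {1, - 1}" using quad_char_nonzero[of "- 1"] by simp
  hence "quad_char (- 1) ^ h \<in> {1, - 1}" by (rule sign_power)
  moreover have "gauss ^ (2 * h) = quad_char (- 1) ^ h * of_nat p ^ h"
    by (simp only: power_mult gauss_squared power_mult_distrib)
  ultimately show ?thesis by blast
qed

lemma gauss_power_val: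
  assumes "i \<le> m"
  shows "\<exists>\<delta>\<in>{1, - 1}. gauss ^ (m - i) * of_nat p ^ i = \<delta> * val i"
proof (cases "even i")
  case True
  hence "odd (m - i)" using odd_m assms by simp
  then obtain h where h: "m - i = 2 * h + 1" by (elim oddE)
  hence hi: "(m + i) div 2 = h + i" using assms by linarith
  obtain \<delta> where d: "\<delta> \<in> {1, - 1}" "gauss ^ (2 * h) = \<delta> * of_nat p ^ h"
    using gauss_power_even by blast
  obtain \<delta>' where d': "\<delta>' \<in> {1, - 1}" "gauss = \<delta>' * sqrt_pstar p"
    using gauss_eq by force
  have "gauss ^ (m - i) * of_nat p ^ i = (\<delta> * \<delta>') * val i"
    unfolding h power_add d(2) power_one_right using d'(2) True
    by (simp add: val_def hi power_add)
  thus ?thesis using sign_mult[OF d(1) d'(1)] by blast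
next
  case False
  hence "even (m - i)" using odd_m assms by simp
  then obtain h where h: "m - i = 2 * h" by (elim evenE)
  hence hi: "(m + i) div 2 = h + i" using assms by linarith
  obtain \<delta> where d: "\<delta> \<in> {1, - 1}" "gauss ^ (2 * h) = \<delta> * of_nat p ^ h"
    using gauss_power_even by blast
  have "gauss ^ (m - i) * of_nat p ^ i = \<delta> * val i"
    unfolding h d(2) using False by (simp add: val_def hi power_add)
  thus ?thesis using d(1) by blast
qed

text \<open>Absolute values separate the coranks, so together with the sign they tell all ten values
  apart; \<open>p ^ m\<close> has the absolute value belonging to corank \<open>m\<close>.\<close>

lemma norm_val: "norm (val i) ^ 2 = real p ^ (m + i)"
proof -
  have s: "norm (sqrt_pstar p) ^ 2 = real p" by (simp add: sqrt_pstar_def norm_mult)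
  show ?thesis
  proof (cases "even i")
    case True
    hence "odd (m + i)" using odd_m by simp
    then obtain h where h: "m + i = 2 * h + 1" by (elim oddE)
    have "norm (val i) ^ 2 = real p * real p ^ (2 * h)"
      using True s by (simp add: val_def norm_mult norm_power h power_mult_distrib power_mult[symmetric] mult.commute[of 2])
    thus ?thesis by (simp add: h)
  next
    case False
    hence "even (m + i)" using odd_m by simp
    then obtain h where h: "m + i = 2 * h" by (elim evenE)
    show ?thesis
      using False by (simp add: val_def norm_mult norm_power h power_mult[symmetric] mult.commute[of 2])
  qed
qed

lemma norm_signed_val: "\<epsilon> \<in> {1, - 1} \<Longrightarrow> norm (\<epsilon> * val i) ^ 2 = real p ^ (m + i)"
  using norm_val[of i] by (auto simp: norm_mult)

lemma val_nonzero: "val i \<noteq> 0"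
  using norm_val[of i] p_gt_2 by auto

lemma signed_val_inj:
  assumes "\<epsilon> \<in> {1, - 1}" "\<delta> \<in> {1, - 1}" "\<epsilon> * val i = \<delta> * val j"
  shows "i = j \<and> \<epsilon> = \<delta>"
proof -
  have "real p ^ (m + i) = real p ^ (m + j)"
    using norm_signed_val[OF assms(1), of i] norm_signed_val[OF assms(2), of j] assms(3) by simp
  hence "i = j" using p_gt_2 by (simp add: power_inject_exp)
  thus ?thesis using assms(3) val_nonzero by simp
qed

lemma signed_val_neq_T_0:
  assumes "\<epsilon> \<in> {1, - 1}" "i < m"
  shows "\<epsilon> * val i \<noteq> of_nat p ^ m"
proof
  assume "\<epsilon> * val i = of_nat p ^ m"
  hence "real p ^ (m + i) = norm (of_nat p ^ m :: complex) ^ 2"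
    using norm_signed_val[OF assms(1), of i] by simp
  also have "\<dots> = real p ^ (m + m)" by (simp add: norm_power power_add power2_eq_square)
  finally show False using p_gt_2 assms(2) by (simp add: power_inject_exp)
qed

definition nonsquare :: 'a where "nonsquare = (SOME l. l \<in> Fp \<and> quad_char l = - 1)"

lemma nonsquare: "nonsquare \<in> Fp" "quad_char nonsquare = - 1"
  using someI_ex[OF ex_nonsquare[unfolded Bex_def]] by (simp_all add: nonsquare_def)

lemma nonsquare_nonzero: "nonsquare \<noteq> 0"
  using nonsquare by (auto simp: quad_char_0)

text \<open>In a product of the sums for \<open>Q\<close> and \<open>l Q\<close> the common sign is
  squared and \<open>gauss * gauss\<close> is known, leaving
  \<open>quad_char l * quad_char (- 1)\<close> to the power of the rank. The three cases are
  \<open>l = - 1\<close>, \<open>l = - nonsquare\<close> and, without a product,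
  \<open>l = nonsquare\<close>.\<close>

lemma T_products_exist:
  assumes "(\<alpha>, \<beta>, \<gamma>) \<noteq> (0, 0, 0)"
  shows "\<exists>i\<le>4. \<exists>\<epsilon>\<in>{1, - 1}. T \<alpha> \<beta> \<gamma> = \<epsilon> * val i \<and>
    T \<alpha> \<beta> \<gamma> * T (- \<alpha>) (- \<beta>) (- \<gamma>) = of_nat p ^ (m + i) \<and>
    T \<alpha> \<beta> \<gamma> * T (- (nonsquare * \<alpha>)) (- (nonsquare * \<beta>)) (- (nonsquare * \<gamma>)) =
      (- 1) ^ Suc i * of_nat p ^ (m + i) \<and>
    T (nonsquare * \<alpha>) (nonsquare * \<beta>) (nonsquare * \<gamma>) = (- 1) ^ Suc i * T \<alpha> \<beta> \<gamma>"
proof -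
  obtain i \<epsilon> where i: "i \<le> 4" "i \<le> m" and e: "\<epsilon> \<in> {1, - 1}" and
    T: "\<And>l. l \<in> Fp \<Longrightarrow> l \<noteq> 0 \<Longrightarrow> T (l * \<alpha>) (l * \<beta>) (l * \<gamma>) =
       \<epsilon> * (quad_char l * gauss) ^ (m - i) * of_nat p ^ i"
    using T_classification[OF assms] by blast
  obtain \<delta> where d: "\<delta> \<in> {1, - 1}" "gauss ^ (m - i) * of_nat p ^ i = \<delta> * val i"
    using gauss_power_val[OF i(2)] by blast
  have ee: "\<epsilon> * \<epsilon> = 1" using e by auto
  have T1: "T \<alpha> \<beta> \<gamma> = \<epsilon> * gauss ^ (m - i) * of_nat p ^ i"
    using T[OF Fp_1] by (simp add: quad_char_1)
  \<comment> \<open>As \<open>m\<close> is odd, the rank \<open>m - i\<close> has the parity of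
    \<open>i + 1\<close>.\<close>
  have par: "(- 1 :: complex) ^ (m - i) = (- 1) ^ Suc i"
    using odd_m i(2) by (cases "even i") auto
  have nn: "- nonsquare \<in> Fp" "- nonsquare \<noteq> 0"
    using nonsquare nonsquare_nonzero by (auto intro: Fp_uminus)
  have gg: "gauss * gauss = quad_char (- 1) * of_nat p"
    using gauss_squared by (simp add: power2_eq_square)
  have qq: "quad_char (- 1) * quad_char (- 1) = 1" using quad_char_nonzero[of "- 1"] by auto
  have prod: "T \<alpha> \<beta> \<gamma> * T (l * \<alpha>) (l * \<beta>) (l * \<gamma>) =
      (quad_char l * quad_char (- 1)) ^ (m - i) * of_nat p ^ (m + i)" if l: "l \<in> Fp" "l \<noteq> 0" for l
  proof -
    have "T \<alpha> \<beta> \<gamma> * T (l * \<alpha>) (l * \<beta>) (l * \<gamma>) =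
        (\<epsilon> * \<epsilon>) * (quad_char l * (gauss * gauss)) ^ (m - i) * (of_nat p ^ i * of_nat p ^ i)"
      unfolding T1 T[OF l] by (simp add: power_mult_distrib mult_ac)
    also have "\<dots> = (quad_char l * quad_char (- 1)) ^ (m - i) * (of_nat p ^ (m - i) * of_nat p ^ i * of_nat p ^ i)"
      unfolding ee gg by (simp add: power_mult_distrib mult_ac)
    also have "of_nat p ^ (m - i) * of_nat p ^ i * of_nat p ^ i = (of_nat p ^ (m + i) :: complex)"
      using i(2) by (simp flip: power_add)
    finally show ?thesis .
  qed
  have "T \<alpha> \<beta> \<gamma> = (\<epsilon> * \<delta>) * val i" unfolding T1 using d(2) by (simp add: mult.assoc)
  moreover have "\<epsilon> * \<delta> \<in> {1, - 1}" using e d(1) by (rule sign_mult)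
  moreover have "T \<alpha> \<beta> \<gamma> * T (- \<alpha>) (- \<beta>) (- \<gamma>) = of_nat p ^ (m + i)"
    using prod[OF Fp_uminus[OF Fp_1]] by (simp add: qq)
  moreover have "T \<alpha> \<beta> \<gamma> * T (- (nonsquare * \<alpha>)) (- (nonsquare * \<beta>)) (- (nonsquare * \<gamma>)) =
      (- 1) ^ Suc i * of_nat p ^ (m + i)"
  proof -
    have "quad_char (- nonsquare) = quad_char (- 1) * quad_char nonsquare"
      using quad_char_mult[OF Fp_uminus[OF Fp_1] nonsquare(1)] by simp
    hence "quad_char (- nonsquare) * quad_char (- 1) = - 1" using nonsquare(2) qq by simp
    thus ?thesis using prod[OF nn] unfolding par[symmetric] by simp
  qed
  moreover have "T (nonsquare * \<alpha>) (nonsquare * \<beta>) (nonsquare * \<gamma>) = (- 1) ^ Suc i * T \<alpha> \<beta> \<gamma>"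
    unfolding T[OF nonsquare(1) nonsquare_nonzero] T1 nonsquare(2) power_mult_distrib par by simp
  ultimately show ?thesis using i(1) by blast
qed

section \<open>Level sets\<close>

definition level :: "complex \<Rightarrow> nat \<Rightarrow> ('a \<times> 'a \<times> 'a) set" where
  "level \<epsilon> i = {(\<alpha>, \<beta>, \<gamma>). T \<alpha> \<beta> \<gamma> = \<epsilon> * val i}"

context
  assumes m_ge_5: "m \<ge> 5"
begin

text \<open>A value \<open>\<epsilon> * val i\<close> excludes the zero triple and determines
  \<open>i\<close>, so the products are constant on each level, as \<open>sum_levels\<close>
  requires.\<close>

lemma T_products:
  assumes "i \<le> 4" "\<epsilon> \<in> {1, - 1}" "T \<alpha> \<beta> \<gamma> = \<epsilon> * val i"
  shows "T \<alpha> \<beta> \<gamma> * T (- \<alpha>) (- \<beta>) (- \<gamma>) = of_nat p ^ (m + i)"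
    "T \<alpha> \<beta> \<gamma> * T (- (nonsquare * \<alpha>)) (- (nonsquare * \<beta>)) (- (nonsquare * \<gamma>)) =
      (- 1) ^ Suc i * of_nat p ^ (m + i)"
    "T (nonsquare * \<alpha>) (nonsquare * \<beta>) (nonsquare * \<gamma>) = (- 1) ^ Suc i * T \<alpha> \<beta> \<gamma>"
proof -
  have "(\<alpha>, \<beta>, \<gamma>) \<noteq> (0, 0, 0)"
    using assms signed_val_neq_T_0[OF assms(2), of i] m_ge_5 T_0 by auto
  from T_products_exist[OF this] obtain j \<delta> where
    *: "\<delta> \<in> {1, - 1}" "T \<alpha> \<beta> \<gamma> = \<delta> * val j"
    "T \<alpha> \<beta> \<gamma> * T (- \<alpha>) (- \<beta>) (- \<gamma>) = of_nat p ^ (m + j)"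
    "T \<alpha> \<beta> \<gamma> * T (- (nonsquare * \<alpha>)) (- (nonsquare * \<beta>)) (- (nonsquare * \<gamma>)) =
      (- 1) ^ Suc j * of_nat p ^ (m + j)"
    "T (nonsquare * \<alpha>) (nonsquare * \<beta>) (nonsquare * \<gamma>) = (- 1) ^ Suc j * T \<alpha> \<beta> \<gamma>"
    by blast
  have "\<epsilon> * val i = \<delta> * val j" using assms(3) *(2) by simp
  hence "i = j" using signed_val_inj[OF assms(2) *(1)] by blast
  thus "T \<alpha> \<beta> \<gamma> * T (- \<alpha>) (- \<beta>) (- \<gamma>) = of_nat p ^ (m + i)"
    "T \<alpha> \<beta> \<gamma> * T (- (nonsquare * \<alpha>)) (- (nonsquare * \<beta>)) (- (nonsquare * \<gamma>)) =
      (- 1) ^ Suc i * of_nat p ^ (m + i)"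
    "T (nonsquare * \<alpha>) (nonsquare * \<beta>) (nonsquare * \<gamma>) = (- 1) ^ Suc i * T \<alpha> \<beta> \<gamma>"
    using *(3-5) by blast+
qed

lemma T_eq_T_0_iff: "T \<alpha> \<beta> \<gamma> = of_nat p ^ m \<longleftrightarrow> (\<alpha>, \<beta>, \<gamma>) = (0, 0, 0)"
proof (cases "(\<alpha>, \<beta>, \<gamma>) = (0, 0, 0)")
  case False
  from T_products_exist[OF this] obtain i \<epsilon> where
    "i \<le> 4" "\<epsilon> \<in> {1, - 1}" "T \<alpha> \<beta> \<gamma> = \<epsilon> * val i" by blast
  thus ?thesis using signed_val_neq_T_0[of \<epsilon> i] m_ge_5 False by auto
qed (use T_0 in auto)

text \<open>The zero triple and the ten levels partition all triples, so any quantity constant on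
  levels is summed by weighting with their sizes.\<close>

lemma sum_levels:
  fixes h :: "'a \<Rightarrow> 'a \<Rightarrow> 'a \<Rightarrow> complex"
  assumes h: "\<And>i \<epsilon> \<alpha> \<beta> \<gamma>. i \<le> 4 \<Longrightarrow> \<epsilon> \<in> {1, - 1} \<Longrightarrow> T \<alpha> \<beta> \<gamma> = \<epsilon> * val i \<Longrightarrow> h \<alpha> \<beta> \<gamma> = H \<epsilon> i"
  shows "(\<Sum>(\<alpha>, \<beta>, \<gamma>)\<in>UNIV. h \<alpha> \<beta> \<gamma>) = h 0 0 0 +
    (\<Sum>i\<le>4. of_nat (card (level 1 i)) * H 1 i + of_nat (card (level (- 1) i)) * H (- 1) i)"
proof -
  let ?h = "\<lambda>(\<alpha>, \<beta>, \<gamma>). h \<alpha> \<beta> \<gamma>"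
  let ?I = "{1, - 1 :: complex} \<times> {..4 :: nat}"
  have split: "UNIV = {(0, 0, 0)} \<union> (\<Union>(\<epsilon>, i)\<in>?I. level \<epsilon> i)"
    using T_products_exist unfolding level_def by fastforce
  have disj: "{(0, 0, 0)} \<inter> (\<Union>(\<epsilon>, i)\<in>?I. level \<epsilon> i) = {}"
  proof -
    have "(0, 0, 0) \<notin> level \<epsilon> i" if "(\<epsilon>, i) \<in> ?I" for \<epsilon> i
      using signed_val_neq_T_0[of \<epsilon> i] T_0 m_ge_5 that by (auto simp: level_def)
    thus ?thesis by blast
  qed
  have "(\<Sum>(\<alpha>, \<beta>, \<gamma>)\<in>UNIV. h \<alpha> \<beta> \<gamma>) = sum ?h {(0, 0, 0)} + sum ?h (\<Union>(\<epsilon>, i)\<in>?I. level \<epsilon> i)"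
    unfolding split using disj by (intro sum.union_disjoint) auto
  also have "sum ?h (\<Union>(\<epsilon>, i)\<in>?I. level \<epsilon> i) = (\<Sum>(\<epsilon>, i)\<in>?I. sum ?h (level \<epsilon> i))"
    unfolding case_prod_unfold
  proof (intro sum.UNION_disjoint ballI impI)
    fix x y assume "x \<in> ?I" "y \<in> ?I" "x \<noteq> y"
    thus "level (fst x) (snd x) \<inter> level (fst y) (snd y) = {}"
      using signed_val_inj[of "fst x" "fst y" "snd x" "snd y"] by (auto simp: level_def)
  qed auto
  also have "\<dots> = (\<Sum>(\<epsilon>, i)\<in>?I. of_nat (card (level \<epsilon> i)) * H \<epsilon> i)"
  proof (rule sum.cong[OF refl])
    fix x assume "x \<in> ?I"
    then obtain \<epsilon> i where x: "x = (\<epsilon>, i)" "\<epsilon> \<in> {1, - 1}" "i \<le> 4" by blast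
    hence "sum ?h (level \<epsilon> i) = (\<Sum>_\<in>level \<epsilon> i. H \<epsilon> i)"
      by (intro sum.cong refl) (auto simp: level_def h)
    thus "(case x of (\<epsilon>, i) \<Rightarrow> sum ?h (level \<epsilon> i)) =
        (case x of (\<epsilon>, i) \<Rightarrow> of_nat (card (level \<epsilon> i)) * H \<epsilon> i)"
      by (simp add: x(1))
  qed
  also have "\<dots> = (\<Sum>\<epsilon>\<in>{1, - 1}. \<Sum>i\<le>4. of_nat (card (level \<epsilon> i)) * H \<epsilon> i)"
    by (rule sum.cartesian_product[symmetric])
  finally show ?thesis by (simp add: sum.distrib)
qed

lemma card_level_even:
  assumes "i \<le> 4" "even i"
  shows "card (level (- 1) i) = card (level 1 i)"
proof -
  let ?f = "\<lambda>(\<alpha>, \<beta>, \<gamma>). (nonsquare * \<alpha>, nonsquare * \<beta>, nonsquare * \<gamma>)"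
  have inj: "inj_on ?f A" for A using nonsquare_nonzero by (auto simp: inj_on_def)
  have neg: "T (nonsquare * \<alpha>) (nonsquare * \<beta>) (nonsquare * \<gamma>) = - (\<epsilon> * val i)"
    if "\<epsilon> \<in> {1, - 1}" "T \<alpha> \<beta> \<gamma> = \<epsilon> * val i" for \<epsilon> \<alpha> \<beta> \<gamma>
    using T_products(3)[OF assms(1) that] assms(2) that(2) by simp
  have "card (level 1 i) \<le> card (level (- 1) i)"
    by (rule card_inj_on_le[OF inj]) (use neg[of 1] in \<open>auto simp: level_def\<close>)
  moreover have "card (level (- 1) i) \<le> card (level 1 i)"
    by (rule card_inj_on_le[OF inj]) (use neg[of "- 1"] in \<open>auto simp: level_def\<close>)
  ultimately show ?thesis by simp
qed

text \<open>The sign of \<open>T 0 0 1\<close> is unknown, but either sign will do because the two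
  levels of corank 0 have equal size.\<close>

lemma card_level_0_pos: "card (level 1 0) > 0"
proof -
  obtain \<epsilon> where e: "\<epsilon> \<in> {1, - 1}" "T 0 0 1 = \<epsilon> * gauss ^ m"
    using T_square_part[of 1] by auto
  obtain \<delta> where d: "\<delta> \<in> {1, - 1}" "gauss ^ m = \<delta> * val 0"
    using gauss_power_val[OF le0] unfolding diff_zero power_0 mult_1_right by blast
  have "(0, 0, 1) \<in> level (\<epsilon> * \<delta>) 0" using e d by (simp add: level_def)
  hence "card (level (\<epsilon> * \<delta>) 0) > 0" by (auto simp: card_gt_0_iff)
  moreover have "\<epsilon> * \<delta> \<in> {1, - 1}" using e d by (intro sign_mult)
  ultimately show ?thesis using card_level_even[of 0] by auto
qed

lemma sum_levels_real:
  assumes "h 0 0 0 = complex_of_real c"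
    and "\<And>i \<epsilon> \<alpha> \<beta> \<gamma>. i \<le> 4 \<Longrightarrow> \<epsilon> \<in> {1, - 1} \<Longrightarrow> T \<alpha> \<beta> \<gamma> = \<epsilon> * val i \<Longrightarrow>
      h \<alpha> \<beta> \<gamma> = complex_of_real (g i)"
  shows "(\<Sum>(\<alpha>, \<beta>, \<gamma>)\<in>UNIV. h \<alpha> \<beta> \<gamma>) = complex_of_real
    (c + (\<Sum>i\<le>4. (real (card (level 1 i)) + real (card (level (- 1) i))) * g i))"
  using sum_levels[of h "\<lambda>_ i. complex_of_real (g i)", OF assms(2)] assms(1)
  by (simp add: distrib_right)

section \<open>Solving for the frequencies\<close>

lemma card_levels:
  shows "\<epsilon> \<in> {1, - 1} \<Longrightarrow> real (card (level (of_int \<epsilon>) 1)) = freq1 \<epsilon> p m"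
    "\<epsilon> \<in> {1, - 1} \<Longrightarrow> real (card (level (of_int \<epsilon>) 3)) = freq3 \<epsilon> p m"
    "\<epsilon> \<in> {1, - 1} \<Longrightarrow> real (card (level (of_int \<epsilon>) 2)) = freq2 p m"
    "\<epsilon> \<in> {1, - 1} \<Longrightarrow> real (card (level (of_int \<epsilon>) 4)) = freq4 p m"
    "\<epsilon> \<in> {1, - 1} \<Longrightarrow> real (card (level (of_int \<epsilon>) 0)) = freq0 p m"
proof -
  \<comment> \<open>With this \<open>N\<close> every exponent in the frequencies has the form
    \<open>c * N + d\<close> with natural numbers \<open>c\<close> and \<open>d\<close>, so all
    powers become monomials in \<open>P\<close> and \<open>y = P ^ N\<close>.\<close>
  obtain N where N: "m = 2 * N + 5"
  proof -
    obtain n where "m = 2 * n + 1" using odd_m by (elim oddE)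
    thus ?thesis using that[of "n - 2"] m_ge_5 by simp
  qed
  define P where "P = real p"
  define y where "y = P ^ N"
  define Q where "Q = real q"
  define a b :: "nat \<Rightarrow> real" where "a i = card (level 1 i)" and "b i = card (level (- 1) i)" for i
  have P: "P > 1" using p_gt_2 by (simp add: P_def)
  have y: "y > 0" using P by (simp add: y_def)
  have pow: "P ^ (c * N + d) = y ^ c * P ^ d" "P ^ (N + d) = y * P ^ d" for c d
    by (simp_all add: y_def power_add power_mult mult.commute[of c])
  have Q: "Q = P ^ 5 * y ^ 2" using pow(1)[of 2 5] by (simp add: Q_def P_def N)
  \<comment> \<open>These bounds make the truncated subtractions in the point counts agree with
    subtraction of reals.\<close>
  have q: "p ^ m \<ge> 1" "p ^ m \<ge> p" using p_gt_2 m_ge_5 power_increasing[of 1 m p] by auto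
  have pm: "of_nat p ^ (m + i) = complex_of_real (Q * P ^ i)" for i
    by (simp add: Q_def P_def power_add)
  have ca: "of_nat (card (level 1 i)) = complex_of_real (a i)"
    and cb: "of_nat (card (level (- 1) i)) = complex_of_real (b i)" for i
    by (simp_all add: a_def b_def)
  have T00: "T 0 0 0 = complex_of_real Q" by (simp add: T_0 Q_def)
  have half: "(m + 1) div 2 = N + 3" "(m + 3) div 2 = N + 4" using N by simp_all
  have pP: "(of_nat p :: complex) = complex_of_real P" by (simp add: P_def)
  have v1: "val 1 = complex_of_real (P ^ 3 * y)"
    unfolding val_def half(1) pP mult.commute[of _ y] pow(2)[symmetric] by simp
  have v3: "val 3 = complex_of_real (P ^ 4 * y)"
    unfolding val_def half(2) pP mult.commute[of _ y] pow(2)[symmetric] by simp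
  have ab: "b 0 = a 0" "b 2 = a 2" "b 4 = a 4"
    using card_level_even by (simp_all add: a_def b_def)
  have e0: "Q ^ 3 = 1 + (\<Sum>i\<le>4. a i + b i)"
  proof -
    have "(\<Sum>(\<alpha> :: 'a, \<beta> :: 'a, \<gamma> :: 'a)\<in>UNIV. 1 :: complex) = complex_of_real (Q ^ 3)"
      by (simp add: case_prod_unfold card_field Q_def power3_eq_cube)
    also have "(\<Sum>(\<alpha> :: 'a, \<beta> :: 'a, \<gamma> :: 'a)\<in>UNIV. 1 :: complex) =
        complex_of_real (1 + (\<Sum>i\<le>4. (a i + b i) * 1))"
      unfolding a_def b_def by (rule sum_levels_real) simp_all
    finally show ?thesis unfolding of_real_eq_iff by simp
  qed
  have e2: "Q ^ 3 * (2 * Q - 1) = Q ^ 2 + (\<Sum>i\<le>4. (a i + b i) * (Q * P ^ i))"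
  proof -
    have "complex_of_real (Q ^ 3 * (2 * Q - 1)) = of_nat (q ^ 3 * (2 * q - 1))"
      using q by (simp add: Q_def of_nat_diff)
    also have "\<dots> = complex_of_real (Q ^ 2 + (\<Sum>i\<le>4. (a i + b i) * (Q * P ^ i)))"
      unfolding moment_T_conj[symmetric] a_def b_def
    proof (rule sum_levels_real, goal_cases)
      case 1
      show ?case by (simp add: T00 power2_eq_square power4_eq_xxxx)
    next
      case (2 i \<epsilon> \<alpha> \<beta> \<gamma>)
      show ?case unfolding T_products(1)[OF 2] pm by (simp add: power2_eq_square)
    qed
    finally show ?thesis unfolding of_real_eq_iff .
  qed
  have e2': "Q ^ 3 = Q ^ 2 + (\<Sum>i\<le>4. (a i + b i) * ((- 1) ^ Suc i * (Q * P ^ i)))"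
  proof -
    have "complex_of_real (Q ^ 3) = of_nat (q ^ 3)" by (simp add: Q_def)
    also have "\<dots> = complex_of_real (Q ^ 2 + (\<Sum>i\<le>4. (a i + b i) * ((- 1) ^ Suc i * (Q * P ^ i))))"
      unfolding moment_T_twist[OF nonsquare, symmetric] a_def b_def
    proof (rule sum_levels_real, goal_cases)
      case 1
      show ?case by (simp add: T00 power2_eq_square power4_eq_xxxx)
    next
      case (2 i \<epsilon> \<alpha> \<beta> \<gamma>)
      show ?case unfolding T_products(2)[OF 2] pm by (simp add: power2_eq_square)
    qed
    finally show ?thesis unfolding of_real_eq_iff .
  qed
  have e4: "Q ^ 3 * (Q * (2 * Q - 1) + (Q - 1) * (Q ^ 2 - (Q - P) ^ 2)) =
      Q ^ 4 + (\<Sum>i\<le>4. (a i + b i) * (Q * P ^ i) ^ 2)"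
  proof -
    have le: "(q - p) ^ 2 \<le> q ^ 2" by (intro power_mono) auto
    have "complex_of_real (Q ^ 3 * (Q * (2 * Q - 1) + (Q - 1) * (Q ^ 2 - (Q - P) ^ 2))) =
        of_nat (q ^ 3 * (q * (2 * q - 1) + (q - 1) * (q ^ 2 - (q - p) ^ 2)))"
      using q le by (simp add: Q_def P_def of_nat_diff)
    also have "\<dots> = complex_of_real (Q ^ 4 + (\<Sum>i\<le>4. (a i + b i) * (Q * P ^ i) ^ 2))"
      unfolding moment_T4[symmetric] a_def b_def
    proof (rule sum_levels_real, goal_cases)
      case 1
      show ?case by (simp add: T00 power2_eq_square power4_eq_xxxx)
    next
      case (2 i \<epsilon> \<alpha> \<beta> \<gamma>)
      show ?case unfolding T_products(1)[OF 2] pm by (simp add: power2_eq_square)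
    qed
    finally show ?thesis unfolding of_real_eq_iff .
  qed
  have e4': "Q ^ 3 * (Q + (Q - 1) * P ^ 2) =
      Q ^ 4 + (\<Sum>i\<le>4. (a i + b i) * ((- 1) ^ Suc i * (Q * P ^ i) ^ 2))"
  proof -
    have "complex_of_real (Q ^ 3 * (Q + (Q - 1) * P ^ 2)) = of_nat (q ^ 3 * (q + (q - 1) * p ^ 2))"
      using q by (simp add: Q_def P_def of_nat_diff)
    also have "\<dots> = complex_of_real (Q ^ 4 + (\<Sum>i\<le>4. (a i + b i) * ((- 1) ^ Suc i * (Q * P ^ i) ^ 2)))"
      unfolding moment_T4_twist[OF nonsquare, symmetric] a_def b_def
    proof (rule sum_levels_real, goal_cases)
      case 1
      show ?case by (simp add: T00 power2_eq_square power4_eq_xxxx)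
    next
      case (2 i \<epsilon> \<alpha> \<beta> \<gamma>)
      show ?case unfolding T_products(1,2)[OF 2] pm by (simp add: power2_eq_square)
    qed
    finally show ?thesis unfolding of_real_eq_iff .
  qed
  have e1: "Q ^ 3 = Q + (a 1 - b 1) * (P ^ 3 * y) + (a 3 - b 3) * (P ^ 4 * y)"
  proof -
    have "complex_of_real (Q ^ 3) = of_nat (q ^ 3)" by (simp add: Q_def)
    also have "\<dots> = complex_of_real Q
        + (\<Sum>i\<le>4. complex_of_real (a i) * (1 * val i) + complex_of_real (b i) * (- 1 * val i))"
      unfolding moment_T[symmetric]
      by (subst sum_levels[where H = "\<lambda>\<epsilon> i. \<epsilon> * val i"]) (simp_all only: ca cb T00)
    \<comment> \<open>For even \<open>i\<close> the two signs cancel by \<open>ab\<close>; with them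
      every \<open>sqrt_pstar p\<close> disappears, and a real equation remains.\<close>
    also have "\<dots> = complex_of_real (Q + (a 1 - b 1) * (P ^ 3 * y) + (a 3 - b 3) * (P ^ 4 * y))"
      unfolding sum_atMost_4 v1 v3 by (simp add: ab algebra_simps)
    finally show ?thesis unfolding of_real_eq_iff .
  qed
  have e3: "Q ^ 3 * (Q + (Q - 1) * P) = Q ^ 3 + (a 1 - b 1) * (P ^ 3 * y * (Q * P))
      + (a 3 - b 3) * (P ^ 4 * y * (Q * P ^ 3))"
  proof -
    have "complex_of_real (Q ^ 3 * (Q + (Q - 1) * P)) = of_nat (q ^ 3 * (q + (q - 1) * p))"
      using q by (simp add: Q_def P_def of_nat_diff)
    also have "\<dots> = complex_of_real (Q * Q * Q) + (\<Sum>i\<le>4. complex_of_real (a i) * (complex_of_real (Q * P ^ i) * (1 * val i))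
        + complex_of_real (b i) * (complex_of_real (Q * P ^ i) * (- 1 * val i)))"
      unfolding moment_T3[symmetric] ca[symmetric] cb[symmetric]
    proof (subst sum_levels[where H = "\<lambda>\<epsilon> i. complex_of_real (Q * P ^ i) * (\<epsilon> * val i)"], goal_cases)
      case (1 i \<epsilon> \<alpha> \<beta> \<gamma>)
      show ?case unfolding T_products(1)[OF 1] pm using 1(3) by simp
    next
      case 2
      show ?case by (simp add: T00)
    qed
    also have "\<dots> = complex_of_real (Q ^ 3 + (a 1 - b 1) * (P ^ 3 * y * (Q * P))
      + (a 3 - b 3) * (P ^ 4 * y * (Q * P ^ 3)))"
      unfolding sum_atMost_4 v1 v3 by (simp add: ab algebra_simps power3_eq_cube)
    finally show ?thesis unfolding of_real_eq_iff .
  qed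
  \<comment> \<open>The common factor of \<open>freq1\<close> and \<open>freq2\<close>.\<close>
  define A where "A = P ^ 10 * y ^ 4 - P ^ 8 * y ^ 4 - P ^ 7 * y ^ 4 + P ^ 3 * y ^ 2 + P ^ 2 * y ^ 2 - 1"
  note sol = solve_moment_equations[OF P y Q A_def ab e0 e2 e2' e4 e4' e1 e3]
  have pows: "P ^ (m + 1) = y ^ 2 * P ^ 6" "P ^ ((m + 3) div 2) = y * P ^ 4"
    "P ^ (2 * m) = y ^ 4 * P ^ 10" "P ^ (2 * m - 1) = y ^ 4 * P ^ 9" "P ^ (2 * m - 2) = y ^ 4 * P ^ 8"
    "P ^ (2 * m - 3) = y ^ 4 * P ^ 7" "P ^ (2 * m - 4) = y ^ 4 * P ^ 6" "P ^ (m - 1) = y ^ 2 * P ^ 4"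
    "P ^ (m - 2) = y ^ 2 * P ^ 3" "P ^ (m - 3) = y ^ 2 * P ^ 2" "P ^ ((m - 3) div 2) = y * P ^ 1"
    unfolding pow[symmetric] using N by (intro arg_cong[where f = "\<lambda>i. P ^ i"]; simp)+
  have A: "A = P ^ (2 * m) - P ^ (2 * m - 2) - P ^ (2 * m - 3) + P ^ (m - 2) + P ^ (m - 3) - 1"
    unfolding pows A_def by (simp add: algebra_simps)
  have Qm: "P ^ m = Q" by (simp add: P_def Q_def)
  have F1: "freq1 \<epsilon> p m = (P ^ 6 * y ^ 2 + of_int \<epsilon> * (P ^ 4 * y)) * A / (2 * (P ^ 2 - 1))" for \<epsilon>
    unfolding freq1_def P_def[symmetric] A[symmetric] unfolding pows by (simp add: mult.commute)
  have F3: "freq3 \<epsilon> p m = (P ^ 2 * y ^ 2 + of_int \<epsilon> * (P * y)) * (P ^ 4 * y ^ 2 - 1) * (Q - 1)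
      / (2 * (P ^ 2 - 1))" for \<epsilon>
    unfolding freq3_def P_def[symmetric] Qm unfolding pows by (simp add: mult.commute)
  have F2: "freq2 p m = P ^ 2 * (P ^ 4 * y ^ 2 - 1) * A / (2 * (P ^ 2 - 1) ^ 2)"
    unfolding freq2_def P_def[symmetric] A[symmetric] unfolding pows by (simp add: mult.commute)
  have F4: "freq4 p m = (Q - 1) * (P ^ 4 * y ^ 2 - 1) * (P ^ 2 * y ^ 2 - 1) / (2 * (P ^ 2 - 1) * (P ^ 4 - 1))"
    unfolding freq4_def P_def[symmetric] Qm unfolding pows by (simp add: mult.commute)
  have F0: "freq0 p m = 1 / 2 * (Q - 1) * (P ^ 10 * y ^ 4 - P ^ 9 * y ^ 4 + P ^ 6 * y ^ 4 + Q
        - P ^ 4 * y ^ 2 - P ^ 2 * y ^ 2 + 1) - freq2 p m - freq4 p m"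
    unfolding freq0_def P_def[symmetric] Qm unfolding pows by (simp add: mult.commute)
  show "real (card (level (of_int \<epsilon>) 1)) = freq1 \<epsilon> p m" if "\<epsilon> \<in> {1, - 1}"
    using that sol(1,2) unfolding F1 a_def b_def by auto
  show "real (card (level (of_int \<epsilon>) 3)) = freq3 \<epsilon> p m" if "\<epsilon> \<in> {1, - 1}"
    using that sol(3,4) unfolding F3 a_def b_def by auto
  have ev: "real (card (level (of_int \<epsilon>) i)) = a i" if "\<epsilon> \<in> {1, - 1}" "i \<in> {0, 2, 4}" for \<epsilon> i
    using that card_level_even[of i] by (auto simp: a_def)
  show "real (card (level (of_int \<epsilon>) 2)) = freq2 p m" if "\<epsilon> \<in> {1, - 1}"
    using ev[OF that, of 2] sol(5) F2 by simp
  show "real (card (level (of_int \<epsilon>) 4)) = freq4 p m" if "\<epsilon> \<in> {1, - 1}"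
    using ev[OF that, of 4] sol(6) F4 by simp
  show "real (card (level (of_int \<epsilon>) 0)) = freq0 p m" if "\<epsilon> \<in> {1, - 1}"
    using ev[OF that, of 0] sol(5-7) F0 F2 F4 by simp
qed

text \<open>Positive frequencies show that the listed values are really attained.
  \<open>freq0\<close> is a difference; its level is covered by the explicit form of full
  rank.\<close>

lemma freq_pos:
  "freq2 p m > 0" "freq4 p m > 0" "\<epsilon> \<in> {1, - 1} \<Longrightarrow> freq1 \<epsilon> p m > 0" "\<epsilon> \<in> {1, - 1} \<Longrightarrow> freq3 \<epsilon> p m > 0"
proof -
  define P where "P = real p"
  have P: "P > 2" using p_gt_2 by (simp add: P_def)
  have less: "P ^ i < P ^ j \<longleftrightarrow> i < j" for i j using P by (simp add: power_strict_increasing_iff)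
  have gt1: "P ^ i > 1" if "i > 0" for i using P that by (intro one_less_power) auto
  have A: "P ^ (2 * m) - P ^ (2 * m - 2) - P ^ (2 * m - 3) + P ^ (m - 2) + P ^ (m - 3) - 1 > 0"
  proof -
    \<comment> \<open>Because \<open>P > 2\<close>, the leading power exceeds
      \<open>2 * P ^ (2 * m - 1)\<close> and so dominates both subtracted powers.\<close>
    have "2 * m = 1 + (2 * m - 1)" using m_ge_5 by simp
    hence "P ^ (2 * m) = P * P ^ (2 * m - 1)" by (metis power_add power_one_right)
    moreover have "2 * P ^ (2 * m - 1) < P * P ^ (2 * m - 1)" using P by simp
    moreover have "P ^ (2 * m - 2) < P ^ (2 * m - 1)" "P ^ (2 * m - 3) < P ^ (2 * m - 1)"
      unfolding less using m_ge_5 by auto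
    moreover have "P ^ (m - 2) > 1" "P ^ (m - 3) > 1" using m_ge_5 by (auto intro: gt1)
    ultimately show ?thesis by linarith
  qed
  have pos: "P ^ 2 - 1 > 0" "P ^ 4 - 1 > 0" "P ^ m - 1 > 0" "P ^ (m - 1) - 1 > 0" "P ^ (m - 3) - 1 > 0"
  proof -
    have "P ^ 2 > 1" "P ^ 4 > 1" "P ^ m > 1" "P ^ (m - 1) > 1" "P ^ (m - 3) > 1"
      by (rule gt1, use m_ge_5 in simp)+
    thus "P ^ 2 - 1 > 0" "P ^ 4 - 1 > 0" "P ^ m - 1 > 0" "P ^ (m - 1) - 1 > 0" "P ^ (m - 3) - 1 > 0"
      by linarith+
  qed
  have sgn: "x + of_int \<epsilon> * z > 0" if "\<epsilon> \<in> {1, - 1}" "0 < z" "z < x" for x z :: real and \<epsilon> :: int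
    using that by auto
  show "freq2 p m > 0" unfolding freq2_def P_def[symmetric]
    using pos A P by (intro divide_pos_pos mult_pos_pos zero_less_power) auto
  show "freq4 p m > 0" unfolding freq4_def P_def[symmetric]
    using pos P by (intro divide_pos_pos mult_pos_pos) auto
  have P0: "P > 0" using P by simp
  have lt: "P ^ ((m + 3) div 2) < P ^ (m + 1)" "P ^ ((m - 3) div 2) < P ^ (m - 3)"
    unfolding less using m_ge_5 by linarith+
  show "freq1 \<epsilon> p m > 0" if "\<epsilon> \<in> {1, - 1}" unfolding freq1_def P_def[symmetric]
    by (intro divide_pos_pos mult_pos_pos sgn that zero_less_power P0 lt A pos zero_less_numeral)
  show "freq3 \<epsilon> p m > 0" if "\<epsilon> \<in> {1, - 1}" unfolding freq3_def P_def[symmetric]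
    by (intro divide_pos_pos mult_pos_pos sgn that zero_less_power P0 lt pos zero_less_numeral)
qed

section \<open>The set of values\<close>

lemma level_nonempty:
  assumes "i \<le> 4" "\<epsilon> \<in> {1, - 1 :: complex}"
  shows "level \<epsilon> i \<noteq> {}"
proof -
  obtain s :: int where s: "s \<in> {1, - 1}" "\<epsilon> = of_int s" using assms(2) by force
  have "i \<in> {0, 1, 2, 3, 4}" using assms(1) by auto
  hence "real (card (level \<epsilon> i)) > 0"
    using card_levels(1-4)[OF s(1)] freq_pos(1,2) freq_pos(3,4)[OF s(1)] card_level_0_pos
      card_level_even[of 0] s by (elim insertE emptyE) simp_all
  thus ?thesis by auto
qed

lemma value_set: "{T \<alpha> \<beta> \<gamma> | \<alpha> \<beta> \<gamma>. True} =
    (\<Union>i\<in>{0, 1, 2, 3, 4}. {val i, - val i}) \<union> {of_nat p ^ m}" (is "?L = ?R")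
proof
  show "?L \<subseteq> ?R"
  proof
    fix z assume "z \<in> ?L"
    then obtain \<alpha> \<beta> \<gamma> where z: "z = T \<alpha> \<beta> \<gamma>" by blast
    show "z \<in> ?R"
    proof (cases "(\<alpha>, \<beta>, \<gamma>) = (0, 0, 0)")
      case False
      from T_products_exist[OF this] obtain i \<epsilon> where
        i: "i \<le> 4" "\<epsilon> \<in> {1, - 1}" "T \<alpha> \<beta> \<gamma> = \<epsilon> * val i" by blast
      hence "z \<in> {val i, - val i}" using z by auto
      moreover have "i \<in> {0, 1, 2, 3, 4}" using i(1) by auto
      ultimately show ?thesis by blast
    qed (simp add: z T_0)
  qed
  have "\<epsilon> * val i \<in> ?L" if "i \<in> {0, 1, 2, 3, 4}" "\<epsilon> \<in> {1, - 1}" for i \<epsilon>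
  proof -
    have "i \<le> 4" using that(1) by auto
    from level_nonempty[OF this that(2)] obtain \<alpha> \<beta> \<gamma> where "T \<alpha> \<beta> \<gamma> = \<epsilon> * val i"
      by (auto simp: level_def)
    thus ?thesis by (metis (mono_tags, lifting) mem_Collect_eq)
  qed
  from this[of _ 1] this[of _ "- 1"]
  have "{val i, - val i} \<subseteq> ?L" if "i \<in> {0, 1, 2, 3, 4}" for i
    using that by simp
  moreover have "of_nat p ^ m \<in> ?L" by (metis (mono_tags, lifting) T_0 mem_Collect_eq)
  ultimately show "?R \<subseteq> ?L" by blast
qed

lemma value_distribution:
  shows "{T \<alpha> \<beta> \<gamma> | \<alpha> \<beta> \<gamma>. True} =
      {sqrt_pstar p * of_nat p ^ ((m - 1) div 2), - (sqrt_pstar p * of_nat p ^ ((m - 1) div 2)),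
       of_nat p ^ ((m + 1) div 2), - (of_nat p ^ ((m + 1) div 2)),
       sqrt_pstar p * of_nat p ^ ((m + 1) div 2), - (sqrt_pstar p * of_nat p ^ ((m + 1) div 2)),
       of_nat p ^ ((m + 3) div 2), - (of_nat p ^ ((m + 3) div 2)),
       sqrt_pstar p * of_nat p ^ ((m + 3) div 2), - (sqrt_pstar p * of_nat p ^ ((m + 3) div 2)),
       of_nat p ^ m}
    \<and> (\<forall>\<epsilon>\<in>{1, -1}.
        real (card {(\<alpha>, \<beta>, \<gamma>). T \<alpha> \<beta> \<gamma> = of_int \<epsilon> * (sqrt_pstar p * of_nat p ^ ((m - 1) div 2))}) = freq0 p m
      \<and> real (card {(\<alpha>, \<beta>, \<gamma>). T \<alpha> \<beta> \<gamma> = of_int \<epsilon> * of_nat p ^ ((m + 1) div 2)}) = freq1 \<epsilon> p m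
      \<and> real (card {(\<alpha>, \<beta>, \<gamma>). T \<alpha> \<beta> \<gamma> = of_int \<epsilon> * (sqrt_pstar p * of_nat p ^ ((m + 1) div 2))}) = freq2 p m
      \<and> real (card {(\<alpha>, \<beta>, \<gamma>). T \<alpha> \<beta> \<gamma> = of_int \<epsilon> * of_nat p ^ ((m + 3) div 2)}) = freq3 \<epsilon> p m
      \<and> real (card {(\<alpha>, \<beta>, \<gamma>). T \<alpha> \<beta> \<gamma> = of_int \<epsilon> * (sqrt_pstar p * of_nat p ^ ((m + 3) div 2))}) = freq4 p m)
    \<and> card {(\<alpha>, \<beta>, \<gamma>). T \<alpha> \<beta> \<gamma> = of_nat p ^ m} = 1"
proof -
  obtain n where n: "m = 2 * n + 1" using odd_m by (elim oddE)
  have vals: "val 0 = sqrt_pstar p * of_nat p ^ ((m - 1) div 2)" "val 1 = of_nat p ^ ((m + 1) div 2)"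
    "val 2 = sqrt_pstar p * of_nat p ^ ((m + 1) div 2)" "val 3 = of_nat p ^ ((m + 3) div 2)"
    "val 4 = sqrt_pstar p * of_nat p ^ ((m + 3) div 2)"
  proof -
    have "(m + 0) div 2 = (m - 1) div 2" "(m + 2) div 2 = (m + 1) div 2" "(m + 4) div 2 = (m + 3) div 2"
      using n by simp_all
    thus "val 0 = sqrt_pstar p * of_nat p ^ ((m - 1) div 2)" "val 1 = of_nat p ^ ((m + 1) div 2)"
      "val 2 = sqrt_pstar p * of_nat p ^ ((m + 1) div 2)" "val 3 = of_nat p ^ ((m + 3) div 2)"
      "val 4 = sqrt_pstar p * of_nat p ^ ((m + 3) div 2)"
      unfolding val_def by simp_all
  qed
  have "{(\<alpha>, \<beta>, \<gamma>). T \<alpha> \<beta> \<gamma> = of_nat p ^ m} = {(0, 0, 0)}"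
    unfolding T_eq_T_0_iff by auto
  hence zero: "card {(\<alpha>, \<beta>, \<gamma>). T \<alpha> \<beta> \<gamma> = of_nat p ^ m} = 1" by simp
  show ?thesis
  proof (intro conjI ballI zero)
    show "{T \<alpha> \<beta> \<gamma> | \<alpha> \<beta> \<gamma>. True} =
      {sqrt_pstar p * of_nat p ^ ((m - 1) div 2), - (sqrt_pstar p * of_nat p ^ ((m - 1) div 2)),
       of_nat p ^ ((m + 1) div 2), - (of_nat p ^ ((m + 1) div 2)),
       sqrt_pstar p * of_nat p ^ ((m + 1) div 2), - (sqrt_pstar p * of_nat p ^ ((m + 1) div 2)),
       of_nat p ^ ((m + 3) div 2), - (of_nat p ^ ((m + 3) div 2)),
       sqrt_pstar p * of_nat p ^ ((m + 3) div 2), - (sqrt_pstar p * of_nat p ^ ((m + 3) div 2)),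
       of_nat p ^ m}"
      unfolding value_set UN_insert UN_empty vals Un_insert_left Un_empty_left ..
  qed (use card_levels[unfolded level_def vals] in \<open>simp_all only:\<close>)
qed

end

end

theorem theorem3p1:
  fixes p m k :: nat
    and T :: "'a::finite_field \<Rightarrow> 'a \<Rightarrow> 'a \<Rightarrow> complex"
  assumes "prime p" and "odd p"
    and "odd m" and "m \<ge> 5"
    and "k > 0" and "gcd m k = 1"
    and card_field: "CARD('a) = p ^ m"
    and T_def: "T = exp_sum_T p m k"
  shows "{T \<alpha> \<beta> \<gamma> | \<alpha> \<beta> \<gamma>. True} =
      {sqrt_pstar p * of_nat p ^ ((m - 1) div 2), - (sqrt_pstar p * of_nat p ^ ((m - 1) div 2)),
       of_nat p ^ ((m + 1) div 2), - (of_nat p ^ ((m + 1) div 2)),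
       sqrt_pstar p * of_nat p ^ ((m + 1) div 2), - (sqrt_pstar p * of_nat p ^ ((m + 1) div 2)),
       of_nat p ^ ((m + 3) div 2), - (of_nat p ^ ((m + 3) div 2)),
       sqrt_pstar p * of_nat p ^ ((m + 3) div 2), - (sqrt_pstar p * of_nat p ^ ((m + 3) div 2)),
       of_nat p ^ m}
    \<and> (\<forall>\<epsilon>\<in>{1, -1}.
        real (card {(\<alpha>, \<beta>, \<gamma>). T \<alpha> \<beta> \<gamma> = of_int \<epsilon> * (sqrt_pstar p * of_nat p ^ ((m - 1) div 2))}) = freq0 p m
      \<and> real (card {(\<alpha>, \<beta>, \<gamma>). T \<alpha> \<beta> \<gamma> = of_int \<epsilon> * of_nat p ^ ((m + 1) div 2)}) = freq1 \<epsilon> p m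
      \<and> real (card {(\<alpha>, \<beta>, \<gamma>). T \<alpha> \<beta> \<gamma> = of_int \<epsilon> * (sqrt_pstar p * of_nat p ^ ((m + 1) div 2))}) = freq2 p m
      \<and> real (card {(\<alpha>, \<beta>, \<gamma>). T \<alpha> \<beta> \<gamma> = of_int \<epsilon> * of_nat p ^ ((m + 3) div 2)}) = freq3 \<epsilon> p m
      \<and> real (card {(\<alpha>, \<beta>, \<gamma>). T \<alpha> \<beta> \<gamma> = of_int \<epsilon> * (sqrt_pstar p * of_nat p ^ ((m + 3) div 2))}) = freq4 p m)
    \<and> card {(\<alpha>, \<beta>, \<gamma>). T \<alpha> \<beta> \<gamma> = of_nat p ^ m} = 1"
proof -
  have "quadratic_family TYPE('a) p m k"
    using assms by unfold_locales auto
  thus ?thesis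
    unfolding T_def using \<open>m \<ge> 5\<close> by (rule quadratic_family.value_distribution)
qed

end
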